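(* Let $p$ be a prime and let $M$ be a regular matroid on a finite ground set $E$ with $\#E=n$, and suppose $\Psi_M\neq 1$. Then the density $\mu(\mathcal{J}_p(M))$ exists and \[ \mu(\mathcal{J}_p(M))=\frac{(p-1)\,\#X_M(\mathbb{F}_p)+1}{(p-1)\,\#\mathbb{P}^{n-1}_{\mathbb{F}_p}(\mathbb{F}_p)+1}, \] where $\mathcal{J}_p(M)=\{\lambda\in\mathbb{N}^{E} : p \mid \#\mathrm{Jac}(M_\lambda)\}$.
   Context: $\mathbb{N}$ denotes the positive integers. Metric matroid: for a matroid $M$ on $E(M)$ and $\lambda\colon E(M)\to\mathbb{N}$, choose pairwise disjoint finite sets $E_e$ ($e\in E(M)$) with $\#E_e=\lambda(e)$ and $e\in E_e$; put $E(M_\lambda)=\bigsqcup_{e\in E(M)}E_e$. The matroid $M_\lambda$ on $E(M_\lambda)$ has as bases exactly the sets $E(M_\lambda)-\{x_e : e\notin B'\}$, where $B'$ is a basis of $M$ and $x_e\in E_e$ for each $e\in E(M)-B'$. If $M$ is regular then $M_\lambda$ is regular. Jacobian group of a regular matroid $N$ on $n$ elements: take an $r\times n$ totally unimodular integer matrix $A$ of rank $r$ representing $N$ over $\mathbb{Q}$, let $\Lambda=\ker A\cap\mathbb{Z}^n$ and $\Lambda^\#=\{x\in\ker A:\langle x,y\rangle\in\mathbb{Z}\ \forall y\in\Lambda\}$ (standard inner product); $\mathrm{Jac}(N)=\Lambda^\#/\Lambda$ (well defined up to isomorphism). Configuration polynomial: $\Psi_M=\sum_{B}\prod_{e\notin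 B}\lambda_e\in\mathbb{Z}[\lambda_e : e\in E]$, the sum over all bases $B$ of $M$ (an empty product is $1$). The configuration hypersurface over $\mathbb{F}_p$ is $X_M=\mathrm{Proj}\,\mathbb{F}_p[\lambda_e : e\in E]/(\Psi_M)\subseteq\mathbb{P}^{n-1}_{\mathbb{F}_p}$, and $X_M(\mathbb{F}_p)$ is its set of $\mathbb{F}_p$-rational points. Height of $\lambda\in\mathbb{N}^E$: $\mathrm{ht}(\lambda)=\max_{e\in E}\lambda(e)$. Density of $S\subseteq\mathbb{N}^E$: $\mu(S)=\lim_{m\to\infty}\#(S\cap\{\lambda:\mathrm{ht}(\lambda)\le m\})/\#\{\lambda\in\mathbb{N}^E:\mathrm{ht}(\lambda)\le m\}$, when the limit exists. *)

theory Defs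
  imports Complex_Main "HOL-Library.Poly_Mapping" "Jordan_Normal_Form.Determinant"
begin

definition matroid_bases :: "'a set \<Rightarrow> 'a set set \<Rightarrow> bool" where
  "matroid_bases E \<B> \<longleftrightarrow> finite E \<and> \<B> \<noteq> {} \<and> (\<forall>B\<in>\<B>. B \<subseteq> E) \<and>
     (\<forall>B1\<in>\<B>. \<forall>B2\<in>\<B>. \<forall>x\<in>B1 - B2. \<exists>y\<in>B2 - B1. insert y (B1 - {x}) \<in> \<B>)"

definition totally_unimodular :: "'a set \<Rightarrow> nat \<Rightarrow> (nat \<Rightarrow> 'a \<Rightarrow> int) \<Rightarrow> bool" where
  "totally_unimodular E r A \<longleftrightarrow>
     (\<forall>is js. distinct is \<and> distinct js \<and> length is = length js \<and> set is \<subseteq> {..<r} \<and> set js \<subseteq> E \<longrightarrow>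
        det (mat (length is) (length is) (\<lambda>(a,b). A (is ! a) (js ! b))) \<in> {-1, 0, 1})"

definition full_row_rank :: "'a set \<Rightarrow> nat \<Rightarrow> (nat \<Rightarrow> 'a \<Rightarrow> int) \<Rightarrow> bool" where
  "full_row_rank E r A \<longleftrightarrow>
     (\<forall>c :: nat \<Rightarrow> rat. (\<forall>e\<in>E. (\<Sum>i<r. c i * of_int (A i e)) = 0) \<longrightarrow> (\<forall>i<r. c i = 0))"

definition col_basis :: "'a set \<Rightarrow> nat \<Rightarrow> (nat \<Rightarrow> 'a \<Rightarrow> int) \<Rightarrow> 'a set \<Rightarrow> bool" where
  "col_basis E r A B \<longleftrightarrow> B \<subseteq> E \<and> card B = r \<and>
     (\<forall>c :: 'a \<Rightarrow> rat. (\<forall>i<r. (\<Sum>e\<in>B. c e * of_int (A i e)) = 0) \<longrightarrow> (\<forall>e\<in>B. c e = 0))"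

definition tu_rep :: "'a set \<Rightarrow> 'a set set \<Rightarrow> nat \<Rightarrow> (nat \<Rightarrow> 'a \<Rightarrow> int) \<Rightarrow> bool" where
  "tu_rep E \<B> r A \<longleftrightarrow> totally_unimodular E r A \<and> full_row_rank E r A \<and>
     \<B> = {B. col_basis E r A B}"

definition regular_matroid :: "'a set \<Rightarrow> 'a set set \<Rightarrow> bool" where
  "regular_matroid E \<B> \<longleftrightarrow> matroid_bases E \<B> \<and> (\<exists>r A. tu_rep E \<B> r A)"

definition ker_Q :: "'a set \<Rightarrow> nat \<Rightarrow> (nat \<Rightarrow> 'a \<Rightarrow> int) \<Rightarrow> ('a \<Rightarrow> rat) set" where
  "ker_Q E r A = {x. (\<forall>e. e \<notin> E \<longrightarrow> x e = 0) \<and> (\<forall>i<r. (\<Sum>e\<in>E. of_int (A i e) * x e) = 0)}"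

definition lattice_Lambda :: "'a set \<Rightarrow> nat \<Rightarrow> (nat \<Rightarrow> 'a \<Rightarrow> int) \<Rightarrow> ('a \<Rightarrow> rat) set" where
  "lattice_Lambda E r A = {x \<in> ker_Q E r A. \<forall>e. x e \<in> \<int>}"

definition lattice_dual :: "'a set \<Rightarrow> nat \<Rightarrow> (nat \<Rightarrow> 'a \<Rightarrow> int) \<Rightarrow> ('a \<Rightarrow> rat) set" where
  "lattice_dual E r A = {x \<in> ker_Q E r A. \<forall>y\<in>lattice_Lambda E r A. (\<Sum>e\<in>E. x e * y e) \<in> \<int>}"

definition jac_set :: "'a set \<Rightarrow> nat \<Rightarrow> (nat \<Rightarrow> 'a \<Rightarrow> int) \<Rightarrow> ('a \<Rightarrow> rat) set set" where
  "jac_set E r A = lattice_dual E r A //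
     {(x, y). x \<in> lattice_dual E r A \<and> y \<in> lattice_dual E r A \<and> x - y \<in> lattice_Lambda E r A}"

text \<open>#Jac(N) for a regular matroid N (independent of the chosen representation).\<close>
definition jac_card :: "'a set \<Rightarrow> 'a set set \<Rightarrow> nat" where
  "jac_card E \<B> = (SOME k. \<exists>r A. tu_rep E \<B> r A \<and> k = card (jac_set E r A))"

text \<open>E_e = {(e,i). i < lambda e}, with e identified with (e,0).\<close>
definition metric_ground :: "'a set \<Rightarrow> ('a \<Rightarrow> nat) \<Rightarrow> ('a \<times> nat) set" where
  "metric_ground E w = {(e, i). e \<in> E \<and> i < w e}"

definition metric_bases :: "'a set \<Rightarrow> 'a set set \<Rightarrow> ('a \<Rightarrow> nat) \<Rightarrow> ('a \<times> nat) set set" where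
  "metric_bases E \<B> w = {metric_ground E w - {(e, x e) | e. e \<in> E - B'} | B' x.
      B' \<in> \<B> \<and> (\<forall>e\<in>E - B'. x e < w e)}"

definition config_poly :: "'a set \<Rightarrow> 'a set set \<Rightarrow> ('a \<Rightarrow>\<^sub>0 nat) \<Rightarrow>\<^sub>0 int" where
  "config_poly E \<B> = (\<Sum>B\<in>\<B>. Poly_Mapping.single (\<Sum>e\<in>E - B. Poly_Mapping.single e 1) 1)"

definition mpoly_eval :: "(('a \<Rightarrow>\<^sub>0 nat) \<Rightarrow>\<^sub>0 int) \<Rightarrow> ('a \<Rightarrow> int) \<Rightarrow> int" where
  "mpoly_eval P x = (\<Sum>m\<in>Poly_Mapping.keys P. Poly_Mapping.lookup P m * (\<Prod>e\<in>Poly_Mapping.keys m. x e ^ Poly_Mapping.lookup m e))"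

definition Fp_vectors :: "nat \<Rightarrow> 'a set \<Rightarrow> ('a \<Rightarrow> int) set" where
  "Fp_vectors p E = {x. (\<forall>e\<in>E. 0 \<le> x e \<and> x e < int p) \<and> (\<forall>e. e \<notin> E \<longrightarrow> x e = 0)}"

definition proj_rel :: "nat \<Rightarrow> 'a set \<Rightarrow> (('a \<Rightarrow> int) \<times> ('a \<Rightarrow> int)) set" where
  "proj_rel p E = {(x, y). x \<in> Fp_vectors p E - {\<lambda>_. 0} \<and> y \<in> Fp_vectors p E - {\<lambda>_. 0} \<and>
      (\<exists>a::int. 0 < a \<and> a < int p \<and> y = (\<lambda>e. (a * x e) mod int p))}"

definition proj_points :: "nat \<Rightarrow> 'a set \<Rightarrow> ('a \<Rightarrow> int) set set" where
  "proj_points p E = (Fp_vectors p E - {\<lambda>_. 0}) // proj_rel p E"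

definition config_points :: "nat \<Rightarrow> 'a set \<Rightarrow> 'a set set \<Rightarrow> ('a \<Rightarrow> int) set set" where
  "config_points p E \<B> = {c \<in> proj_points p E. \<forall>x\<in>c. int p dvd mpoly_eval (config_poly E \<B>) x}"

text \<open>Elements of N^E (positive integers), zero outside E, of height at most m.\<close>
definition height_box :: "'a set \<Rightarrow> nat \<Rightarrow> ('a \<Rightarrow> nat) set" where
  "height_box E m = {w. (\<forall>e\<in>E. 1 \<le> w e \<and> w e \<le> m) \<and> (\<forall>e. e \<notin> E \<longrightarrow> w e = 0)}"

definition density_ratio :: "'a set \<Rightarrow> ('a \<Rightarrow> nat) set \<Rightarrow> nat \<Rightarrow> real" where
  "density_ratio E S m = real (card (S \<inter> height_box E m)) / real (card (height_box E m))"

definition Jp_set :: "nat \<Rightarrow> 'a set \<Rightarrow> 'a set set \<Rightarrow> ('a \<Rightarrow> nat) set" where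
  "Jp_set p E \<B> = {w. (\<forall>e\<in>E. 1 \<le> w e) \<and> (\<forall>e. e \<notin> E \<longrightarrow> w e = 0) \<and>
      p dvd jac_card (metric_ground E w) (metric_bases E \<B> w)}"

end

theory Submission
  imports Defs
begin

text \<open>
  For a totally unimodular matrix \<open>A\<close> representing a matroid, a basis \<open>B\<close> gives a \<open>\<int>\<close>-basis \<open>U\<close> of
  \<open>\<Lambda> = ker A \<inter> \<int>\<^sup>E\<close>, indexed by \<open>E - B\<close>.  Pairing with \<open>U\<close> identifies \<open>\<Lambda>\<^sup>#\<close> with \<open>\<int>\<^sup>k\<close> and \<open>\<Lambda>\<close> with the
  image of the Gram matrix of \<open>U\<close>, so the order of the Jacobian is the Gram determinant.  By
  Cauchy--Binet this is the sum of the squared maximal minors of \<open>U\<close>, and the minor on \<open>S\<close> is \<open>\<plusminus>1\<close> or \<open>0\<close>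
  according to whether \<open>E - S\<close> is a basis.  Hence the Jacobian of \<open>M\<^sub>\<lambda>\<close> has as many elements as \<open>M\<^sub>\<lambda>\<close> has
  bases, namely \<open>\<Psi>\<^sub>M(\<lambda>)\<close>.  The condition \<open>p dvd \<Psi>\<^sub>M(\<lambda>)\<close> depends only on \<open>\<lambda>\<close> modulo \<open>p\<close>, so the density
  is the proportion of zeros of \<open>\<Psi>\<^sub>M\<close> among the residue vectors; as \<open>\<Psi>\<^sub>M\<close> is homogeneous of positive degree,
  these zeros form the affine cone over the configuration hypersurface.
\<close>

section \<open>The Cauchy--Binet formula\<close>

text \<open>\<open>jac_card\<close> is a choice among all totally unimodular representations, so its
  value is under control only if one exists and all of them give the same number. Counting bases
  settles the second point, because bases belong to the matroid and not to the matrix. Existence is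
  a separate obstacle: \<open>metric_bases\<close> gives the metric matroid by its bases alone, so a
  totally unimodular matrix for it has to be exhibited. Replacing an element by a fibre is a series
  extension; the kernel vectors of the new matrix are those of \<open>A\<close> copied along each
  fibre, and one extra row per additional element enforces this. The lattice index is computed by
  integer column operations that carry along an explicit set of coset representatives. In the final
  fraction both numerator and denominator count vectors over the prime field: p - 1 nonzero vectors
  lie over each projective point, and the summand 1 is the origin.\<close>

lemma Cauchy_Binet:
  fixes U V :: "nat \<Rightarrow> 'a \<Rightarrow> 'b::comm_ring_1"
  assumes fin: "finite E"
    and en: "\<And>S. S \<subseteq> E \<Longrightarrow> card S = k \<Longrightarrow> bij_betw (en S) {0..<k} S"
  shows "det (mat k k (\<lambda>(i,j). \<Sum>e\<in>E. U i e * V j e)) =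
    (\<Sum>S | S \<subseteq> E \<and> card S = k. det (mat k k (\<lambda>(i,j). U i (en S j))) * det (mat k k (\<lambda>(i,j). V i (en S j))))"
proof -
  let ?I = "{0..<k}"
  let ?P = "{\<pi>. \<pi> permutes ?I}"
  let ?F = "PiE ?I (\<lambda>_. E)"
  let ?S = "{S. S \<subseteq> E \<and> card S = k}"
  \<comment> \<open>The rows are indexed by the positions of \<open>f\<close>: a repeated value of
    \<open>f\<close> gives two equal rows, and permuting \<open>f\<close> permutes rows.\<close>
  define T where "T f = det (mat k k (\<lambda>(i,j). V j (f i)))" for f :: "nat \<Rightarrow> 'a"
  define h where "h f = (\<Prod>i\<in>?I. U i (f i)) * T f" for f
  have T: "T f = (\<Sum>\<pi>\<in>?P. signof \<pi> * (\<Prod>i\<in>?I. V (\<pi> i) (f i)))" for f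
  proof -
    have "T f = (\<Sum>\<pi>\<in>?P. signof \<pi> * (\<Prod>i\<in>?I. mat k k (\<lambda>(i,j). V j (f i)) $$ (i, \<pi> i)))"
      unfolding T_def by (rule det_def'[of _ k]) simp
    also have "\<dots> = (\<Sum>\<pi>\<in>?P. signof \<pi> * (\<Prod>i\<in>?I. V (\<pi> i) (f i)))"
      by (intro sum.cong refl arg_cong2[where f = "(*)"] prod.cong) (auto simp: permutes_in_image)
    finally show ?thesis .
  qed
  have finF: "finite ?F" using fin by (intro finite_PiE) auto
  have "det (mat k k (\<lambda>(i,j). \<Sum>e\<in>E. U i e * V j e)) =
     (\<Sum>\<pi>\<in>?P. signof \<pi> * (\<Prod>i\<in>?I. mat k k (\<lambda>(i,j). \<Sum>e\<in>E. U i e * V j e) $$ (i, \<pi> i)))"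
    by (rule det_def'[of _ k]) simp
  also have "\<dots> = (\<Sum>\<pi>\<in>?P. signof \<pi> * (\<Prod>i\<in>?I. \<Sum>e\<in>E. U i e * V (\<pi> i) e))"
    by (intro sum.cong refl arg_cong2[where f = "(*)"] prod.cong) (auto simp: permutes_in_image)
  also have "\<dots> = (\<Sum>\<pi>\<in>?P. \<Sum>f\<in>?F. signof \<pi> * (\<Prod>i\<in>?I. U i (f i) * V (\<pi> i) (f i)))"
    using fin by (simp add: prod_sum_PiE sum_distrib_left)
  also have "\<dots> = (\<Sum>f\<in>?F. \<Sum>\<pi>\<in>?P. signof \<pi> * (\<Prod>i\<in>?I. U i (f i) * V (\<pi> i) (f i)))"
    by (rule sum.swap)
  also have "\<dots> = (\<Sum>f\<in>?F. h f)"
    unfolding h_def T by (simp add: sum_distrib_left prod.distrib mult_ac)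
  also have "\<dots> = (\<Sum>f\<in>{f\<in>?F. inj_on f ?I}. h f)"
  proof (rule sum.mono_neutral_right[OF finF], blast, safe)
    fix f assume f: "f \<in> ?F" and "h f \<noteq> 0"
    show "inj_on f ?I"
    proof (rule ccontr)
      assume "\<not> inj_on f ?I"
      then obtain i j where ij: "i < k" "j < k" "i \<noteq> j" "f i = f j" by (auto simp: inj_on_def)
      have "T f = 0" unfolding T_def
        by (rule det_identical_rows[of _ k i j]) (use ij in \<open>auto intro!: eq_vecI\<close>)
      then show False using \<open>h f \<noteq> 0\<close> by (simp add: h_def)
    qed
  qed
  also have "\<dots> = (\<Sum>S\<in>?S. \<Sum>f\<in>{f\<in>{f\<in>?F. inj_on f ?I}. f ` ?I = S}. h f)"
    by (rule sum.group[symmetric]) (use fin finF in \<open>auto simp: card_image\<close>)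
  also have "\<dots> = (\<Sum>S\<in>?S. det (mat k k (\<lambda>(i,j). U i (en S j))) * det (mat k k (\<lambda>(i,j). V i (en S j))))"
  proof (rule sum.cong[OF refl])
    fix S assume "S \<in> ?S"
    then have S: "S \<subseteq> E" "card S = k" by auto
    note b = en[OF S]
    define g where "g = inv_into ?I (en S)"
    have gb: "bij_betw g S ?I" unfolding g_def by (rule bij_betw_inv_into[OF b])
    have eg: "en S (g x) = x" if "x \<in> S" for x
      unfolding g_def using b that by (simp add: bij_betw_inv_into_right)
    have ge: "g (en S i) = i" if "i < k" for i
      unfolding g_def using b that by (simp add: bij_betw_inv_into_left)
    have eS: "en S i \<in> S" if "i < k" for i using b that by (auto simp: bij_betw_def)
    let ?G = "{f\<in>{f\<in>?F. inj_on f ?I}. f ` ?I = S}"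
    \<comment> \<open>The injections with image \<open>S\<close> are the enumeration
      \<open>en S\<close> precomposed with permutations. The inverse witness is the identity from
      \<open>k\<close> on, as \<open>permutes\<close> demands.\<close>
    have "(\<Sum>f\<in>?G. h f) = (\<Sum>\<pi>\<in>?P. h (restrict (en S \<circ> \<pi>) ?I))"
    proof (rule sum.reindex_bij_witness[where i = "\<lambda>\<pi>. restrict (en S \<circ> \<pi>) ?I"
          and j = "\<lambda>f i. if i < k then g (f i) else i"])
      fix f assume f: "f \<in> ?G"
      then have fS: "f i \<in> S" if "i < k" for i using that by auto
      show "restrict (en S \<circ> (\<lambda>i. if i < k then g (f i) else i)) ?I = f"
        using f fS eg by (auto simp: restrict_def PiE_def extensional_def fun_eq_iff)
      then show "h (restrict (en S \<circ> (\<lambda>i. if i < k then g (f i) else i)) ?I) = h f" by simp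
      have "bij_betw (g \<circ> f) ?I ?I"
        using f by (intro bij_betw_trans[OF _ gb]) (auto simp: bij_betw_def)
      then have "bij_betw (\<lambda>i. if i < k then g (f i) else i) ?I ?I"
        by (rule iffD1[OF bij_betw_cong, rotated]) auto
      then show "(\<lambda>i. if i < k then g (f i) else i) \<in> ?P"
        by (auto intro!: bij_imp_permutes)
    next
      fix \<pi> assume "\<pi> \<in> ?P"
      then have p: "\<pi> permutes ?I" by simp
      have lt: "\<pi> i < k \<longleftrightarrow> i < k" for i using permutes_in_image[OF p, of i] by auto
      show "(\<lambda>i. if i < k then g (restrict (en S \<circ> \<pi>) ?I i) else i) = \<pi>"
        using lt ge p by (auto simp: fun_eq_iff permutes_def)
      have "bij_betw (en S \<circ> \<pi>) ?I S"
        by (rule bij_betw_trans[OF permutes_imp_bij[OF p] b])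
      then show "restrict (en S \<circ> \<pi>) ?I \<in> ?G"
      proof -
        assume bb: "bij_betw (en S \<circ> \<pi>) ?I S"
        then have bf: "bij_betw (restrict (en S \<circ> \<pi>) ?I) ?I S"
          by (rule iffD1[OF bij_betw_cong, rotated]) simp
        have "restrict (en S \<circ> \<pi>) ?I \<in> ?F"
          unfolding restrict_PiE_iff using bij_betwE[OF bb] S(1) by blast
        then show ?thesis using bf unfolding bij_betw_def by blast
      qed
    qed
    \<comment> \<open>Undoing the row permutation splits off the sign, and this sign is what turns
      the remaining products of \<open>U\<close> entries into a Leibniz sum.\<close>
    also have "\<dots> = (\<Sum>\<pi>\<in>?P. (signof \<pi> * (\<Prod>i\<in>?I. U i (en S (\<pi> i)))) * T (en S))"
    proof (rule sum.cong[OF refl])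
      fix \<pi> assume "\<pi> \<in> ?P"
      then have p: "\<pi> permutes ?I" by simp
      have lt: "\<pi> i < k \<longleftrightarrow> i < k" for i using permutes_in_image[OF p, of i] by auto
      let ?M = "mat k k (\<lambda>(i,j). V j (en S i))"
      have "T (restrict (en S \<circ> \<pi>) ?I) = det (mat k k (\<lambda>(i,j). ?M $$ (\<pi> i, j)))"
        unfolding T_def by (intro arg_cong[where f = det] eq_matI) (simp_all add: lt)
      also have "\<dots> = signof \<pi> * T (en S)"
        unfolding T_def by (rule det_permute_rows[OF _ p]) simp
      finally show "h (restrict (en S \<circ> \<pi>) ?I) = (signof \<pi> * (\<Prod>i\<in>?I. U i (en S (\<pi> i)))) * T (en S)"
        by (simp add: h_def mult_ac)
    qed
    also have "\<dots> = (\<Sum>\<pi>\<in>?P. signof \<pi> * (\<Prod>i\<in>?I. U i (en S (\<pi> i)))) * T (en S)"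
      by (simp add: sum_distrib_right)
    also have "(\<Sum>\<pi>\<in>?P. signof \<pi> * (\<Prod>i\<in>?I. U i (en S (\<pi> i)))) = 
       (\<Sum>\<pi>\<in>?P. signof \<pi> * (\<Prod>i\<in>?I. mat k k (\<lambda>(i,j). U i (en S j)) $$ (i, \<pi> i)))"
      by (intro sum.cong refl arg_cong2[where f = "(*)"] prod.cong) (auto simp: permutes_in_image)
    also have "\<dots> = det (mat k k (\<lambda>(i,j). U i (en S j)))"
      by (rule det_def'[of _ k, symmetric]) simp
    also have "T (en S) = det (mat k k (\<lambda>(i,j). V i (en S j)))"
    proof -
      have "mat k k (\<lambda>(i,j). V j (en S i)) = transpose_mat (mat k k (\<lambda>(i,j). V i (en S j)))" by auto
      then show ?thesis unfolding T_def by (simp add: det_transpose[of _ k])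
    qed
    finally show "(\<Sum>f\<in>?G. h f) = det (mat k k (\<lambda>(i,j). U i (en S j))) * det (mat k k (\<lambda>(i,j). V i (en S j)))" .
  qed
  finally show ?thesis .
qed

section \<open>Cosets of the image of an integer matrix\<close>

text \<open>Representatives stand in for the quotient of \<open>\<int>^k\<close> by the column
  lattice of \<open>G\<close>: the cardinality of a finite \<open>R\<close> is the lattice index,
  and \<open>R\<close> can be built one coordinate at a time.\<close>

definition coset_transversal :: "nat \<Rightarrow> int mat \<Rightarrow> int vec set \<Rightarrow> bool" where
  "coset_transversal k G R \<longleftrightarrow> R \<subseteq> carrier_vec k \<and>
     (\<forall>z\<in>carrier_vec k. \<exists>!x. x \<in> R \<and> (\<exists>y\<in>carrier_vec k. z = x + G *\<^sub>v y))"

text \<open>The integer matrices \<open>P\<close> and \<open>Q\<close> make the column lattices of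
  \<open>G\<close> and \<open>G'\<close> equal, and a transversal depends on that lattice
  alone.\<close>

lemma coset_transversal_cong:
  assumes G: "G \<in> carrier_mat k k" and G': "G' \<in> carrier_mat k k"
    and P: "P \<in> carrier_mat k k" "G' = G * P" and Q: "Q \<in> carrier_mat k k" "G = G' * Q"
    and R: "coset_transversal k G' R"
  shows "coset_transversal k G R"
proof -
  have "(\<exists>y\<in>carrier_vec k. z = x + G *\<^sub>v y) \<longleftrightarrow> (\<exists>y\<in>carrier_vec k. z = x + G' *\<^sub>v y)" for x z
  proof safe
    fix y :: "int vec" assume y: "y \<in> carrier_vec k"
    have "G *\<^sub>v y = G' *\<^sub>v (Q *\<^sub>v y)"
      using assoc_mult_mat_vec[OF G' Q(1) y] Q(2) by simp
    then show "\<exists>ya\<in>carrier_vec k. x + G *\<^sub>v y = x + G' *\<^sub>v ya"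
      using mult_mat_vec_carrier[OF Q(1) y] by metis
  next
    fix y :: "int vec" assume y: "y \<in> carrier_vec k"
    have "G' *\<^sub>v y = G *\<^sub>v (P *\<^sub>v y)"
      using assoc_mult_mat_vec[OF G P(1) y] P(2) by simp
    then show "\<exists>ya\<in>carrier_vec k. x + G' *\<^sub>v y = x + G *\<^sub>v ya"
      using mult_mat_vec_carrier[OF P(1) y] by metis
  qed
  then show ?thesis using R by (simp add: coset_transversal_def)
qed

lemma coset_transversal_addcol:
  assumes G: "G \<in> carrier_mat k k" and ij: "i < k" "j < k" "i \<noteq> j"
    and R: "coset_transversal k (addcol a i j G) R"
  shows "coset_transversal k G R"
proof (rule coset_transversal_cong[OF G _ _ _ _ _ R])
  let ?G = "addcol a i j G"
  show G': "?G \<in> carrier_mat k k" using G by auto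
  show "addrow_mat k a j i \<in> carrier_mat k k" "addrow_mat k (-a) j i \<in> carrier_mat k k" by auto
  show "?G = G * addrow_mat k a j i" by (rule addcol_mat[OF G ij(2)])
  have "addcol (-a) i j ?G = G" using G ij by (intro eq_matI) auto
  then show "G = ?G * addrow_mat k (-a) j i" using addcol_mat[OF G' ij(2), of "-a" i] by simp
qed

lemma coset_transversal_swapcols:
  assumes G: "G \<in> carrier_mat k k" and ij: "i < k" "j < k"
    and R: "coset_transversal k (swapcols i j G) R"
  shows "coset_transversal k G R"
proof (rule coset_transversal_cong[OF G _ _ _ _ _ R])
  let ?G = "swapcols i j G"
  show G': "?G \<in> carrier_mat k k" using G by auto
  show "swaprows_mat k i j \<in> carrier_mat k k" "swaprows_mat k i j \<in> carrier_mat k k" by auto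
  show "?G = G * swaprows_mat k i j" by (rule swapcols_mat[OF G ij])
  have "swapcols i j ?G = G" using G ij by (intro eq_matI) auto
  then show "G = ?G * swaprows_mat k i j" using swapcols_mat[OF G' ij] by simp
qed

text \<open>The first coordinate of \<open>G *\<^sub>v y\<close> is \<open>d\<close> times that of
  \<open>y\<close>. Hence a representative starts with a remainder modulo
  \<open>\<bar>d\<bar>\<close>, which forces the quotient \<open>q\<close>; the rest of column 0
  then only translates the other coordinates by a multiple of \<open>v\<close>, leaving the same
  problem for the minor.\<close>

lemma coset_transversal_block:
  assumes G: "G \<in> carrier_mat (Suc k) (Suc k)"
    and z: "\<And>j. 0 < j \<Longrightarrow> j < Suc k \<Longrightarrow> G $$ (0,j) = 0"
    and d: "G $$ (0,0) = d" "d \<noteq> 0"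
    and R: "coset_transversal k (mat_delete G 0 0) R"
  shows "coset_transversal (Suc k) G ((\<lambda>(a,y). vCons a y) ` ({0..<\<bar>d\<bar>} \<times> R))"
proof -
  define D where "D = mat_delete G 0 0"
  have D: "D \<in> carrier_mat k k" using G unfolding D_def by (simp add: mat_delete_def)
  have Dij: "D $$ (i,j) = G $$ (Suc i, Suc j)" if "i < k" "j < k" for i j
    using that G unfolding D_def by (simp add: mat_delete_def)
  define v where "v = vec k (\<lambda>i. G $$ (Suc i, 0))"
  have v: "v \<in> carrier_vec k" unfolding v_def by simp
  have RC: "R \<subseteq> carrier_vec k" using R by (simp add: coset_transversal_def)
  have mult: "G *\<^sub>v vCons q y = vCons (d * q) (q \<cdot>\<^sub>v v + D *\<^sub>v y)" if y: "y \<in> carrier_vec k" for q y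
  proof (rule eq_vecI)
    show "dim_vec (G *\<^sub>v vCons q y) = dim_vec (vCons (d * q) (q \<cdot>\<^sub>v v + D *\<^sub>v y))"
      using G D by simp
    fix i assume "i < dim_vec (vCons (d * q) (q \<cdot>\<^sub>v v + D *\<^sub>v y))"
    then have i: "i < Suc k" using D by simp
    have "(G *\<^sub>v vCons q y) $ i = (\<Sum>j\<in>{0..<Suc k}. G $$ (i,j) * vCons q y $ j)"
      using G y i by (simp add: scalar_prod_def)
    also have "\<dots> = G $$ (i,0) * q + (\<Sum>j\<in>{0..<k}. G $$ (i, Suc j) * y $ j)"
      by (simp add: sum.atLeast0_lessThan_Suc_shift del: sum.op_ivl_Suc)
    also have "\<dots> = vCons (d * q) (q \<cdot>\<^sub>v v + D *\<^sub>v y) $ i"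
    proof (cases i)
      case 0 then show ?thesis using z d by simp
    next
      case (Suc i')
      then show ?thesis using i D Dij y by (simp add: v_def scalar_prod_def)
    qed
    finally show "(G *\<^sub>v vCons q y) $ i = vCons (d * q) (q \<cdot>\<^sub>v v + D *\<^sub>v y) $ i" .
  qed
  have vc: "\<exists>q w. y = vCons q w \<and> w \<in> carrier_vec k" if "y \<in> carrier_vec (Suc k)" for y :: "int vec"
    using that by (cases y) auto
  have add: "vCons a x + vCons b y = vCons (a + b) (x + y)" for a b :: int and x y 
    by (intro eq_vecI) (auto simp: less_Suc_eq_0_disj vec_index_vCons split: nat.splits)
  have eq: "vCons a y + G *\<^sub>v vCons q w = vCons (a + d * q) (y + (q \<cdot>\<^sub>v v + D *\<^sub>v w))"
    if "w \<in> carrier_vec k" for a y q w using mult[OF that] add by simp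
  have shift: "z = y + (q \<cdot>\<^sub>v v + D *\<^sub>v w) \<longleftrightarrow> z - q \<cdot>\<^sub>v v = y + D *\<^sub>v w"
    if "z \<in> carrier_vec k" "y \<in> carrier_vec k" "w \<in> carrier_vec k" for z y q w
    using that D v by (auto simp: vec_eq_iff algebra_simps)
  show ?thesis unfolding coset_transversal_def
  proof (intro conjI ballI)
    show "(\<lambda>(a,y). vCons a y) ` ({0..<\<bar>d\<bar>} \<times> R) \<subseteq> carrier_vec (Suc k)" using RC by auto
    fix z :: "int vec" assume "z \<in> carrier_vec (Suc k)"
    then obtain z0 z' where zz: "z = vCons z0 z'" "z' \<in> carrier_vec k" using vc by blast
    define a where "a = z0 mod \<bar>d\<bar>"
    \<comment> \<open>The sign corrects for dividing by \<open>\<bar>d\<bar>\<close> instead of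
      \<open>d\<close>, which may be negative.\<close>
    define q where "q = (z0 div \<bar>d\<bar>) * sgn d"
    have zq: "z0 = a + d * q" unfolding a_def q_def
      by (metis abs_sgn add.commute mult.assoc mult.commute mod_div_mult_eq)
    have a: "a \<in> {0..<\<bar>d\<bar>}" using d by (auto simp: a_def)
    have zc: "z' - q \<cdot>\<^sub>v v \<in> carrier_vec k" using zz v by simp
    have ex1: "\<exists>!x. x \<in> R \<and> (\<exists>y\<in>carrier_vec k. z' - q \<cdot>\<^sub>v v = x + D *\<^sub>v y)"
      using R zc unfolding coset_transversal_def D_def by blast
    then obtain x w where xw: "x \<in> R" "w \<in> carrier_vec k" "z' - q \<cdot>\<^sub>v v = x + D *\<^sub>v w" by blast
    show "\<exists>!x. x \<in> (\<lambda>(a,y). vCons a y) ` ({0..<\<bar>d\<bar>} \<times> R) \<and> (\<exists>y\<in>carrier_vec (Suc k). z = x + G *\<^sub>v y)"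
    proof (rule ex1I)
      have "z' = x + (q \<cdot>\<^sub>v v + D *\<^sub>v w)" using xw shift[OF zz(2) _ xw(2)] RC by blast
      then have "z = vCons a x + G *\<^sub>v vCons q w" using eq[OF xw(2)] zq zz(1) by simp
      moreover have "vCons q w \<in> carrier_vec (Suc k)" using xw(2) by simp
      ultimately show "vCons a x \<in> (\<lambda>(a,y). vCons a y) ` ({0..<\<bar>d\<bar>} \<times> R) \<and>
          (\<exists>y\<in>carrier_vec (Suc k). z = vCons a x + G *\<^sub>v y)" using a xw(1) by force
    next
      fix x' assume "x' \<in> (\<lambda>(a,y). vCons a y) ` ({0..<\<bar>d\<bar>} \<times> R) \<and> (\<exists>y\<in>carrier_vec (Suc k). z = x' + G *\<^sub>v y)"
      then obtain b y q' w' where b: "b \<in> {0..<\<bar>d\<bar>}" "y \<in> R" "x' = vCons b y" "w' \<in> carrier_vec k"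
        and "z = vCons b y + G *\<^sub>v vCons q' w'" using vc by fastforce
      then have e: "z0 = b + d * q'" "z' = y + (q' \<cdot>\<^sub>v v + D *\<^sub>v w')" using eq zz(1) by simp_all
      have "b = z0 mod \<bar>d\<bar>"
        using b(1) unfolding e(1) by (metis abs_sgn atLeastLessThan_iff mod_mult_self2 mod_pos_pos_trivial mult.assoc mult.commute mult_sgn_abs)
      then have ba: "b = a" by (simp add: a_def)
      then have "q' = q" using e(1) zq d by simp
      then have "z' - q \<cdot>\<^sub>v v = y + D *\<^sub>v w'" using e(2) shift[OF zz(2) _ b(4)] b(2) RC by blast
      then have "y = x" using ex1 b xw by blast
      then show "x' = vCons a x" using b ba by simp
    qed
  qed
qed

text \<open>Euclid's algorithm on the first row. While two of its entries are nonzero, a column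
  operation shrinks the sum of absolute values and keeps the determinant; once a single entry is
  left, it is moved to the corner and the size drops. The corner entry is then a factor both of the
  determinant and of the number of representatives.\<close>

lemma coset_transversal_exists:
  assumes "G \<in> carrier_mat k k" "det G \<noteq> 0"
  shows "\<exists>R. finite R \<and> int (card R) = \<bar>det G\<bar> \<and> coset_transversal k G R"
  using assms
proof (induction "(k, \<Sum>j<k. nat \<bar>G $$ (0,j)\<bar>)" arbitrary: k G rule: wf_induct_rule[OF wf_lex_prod[OF wf_less_than wf_less_than]])
  case (1 k G)
  note G = 1(2) and dG = 1(3)
  have IH: "\<exists>R. finite R \<and> int (card R) = \<bar>det H\<bar> \<and> coset_transversal l H R"
    if "l < k \<or> l = k \<and> (\<Sum>j<l. nat \<bar>H $$ (0,j)\<bar>) < (\<Sum>j<k. nat \<bar>G $$ (0,j)\<bar>)"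
      "H \<in> carrier_mat l l" "det H \<noteq> 0" for l H
    using that by (intro 1(1)) auto
  show ?case
  proof (cases k)
    case 0
    have "z = 0\<^sub>v 0" if "z \<in> carrier_vec 0" for z :: "int vec" using that by auto
    moreover have "0\<^sub>v 0 = 0\<^sub>v 0 + G *\<^sub>v 0\<^sub>v 0" using G 0 by (intro eq_vecI) auto
    ultimately have "coset_transversal 0 G {0\<^sub>v 0}"
      unfolding coset_transversal_def by (metis empty_subsetI insert_subset singleton_iff zero_carrier_vec)
    then show ?thesis using G 0 by (intro exI[of _ "{0\<^sub>v 0}"]) simp
  next
    case (Suc l)
    have lap: "det G = (\<Sum>j<k. G $$ (0,j) * cofactor G 0 j)"
      by (rule laplace_expansion_row[OF G]) (simp add: Suc)
    show ?thesis
    proof (cases "\<exists>i j. i < k \<and> j < k \<and> i \<noteq> j \<and> G $$ (0,i) \<noteq> 0 \<and> G $$ (0,j) \<noteq> 0")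
      case True
      then obtain i j where ij: "i < k" "j < k" "i \<noteq> j" "G $$ (0,i) \<noteq> 0" "G $$ (0,j) \<noteq> 0"
        and le: "\<bar>G $$ (0,j)\<bar> \<le> \<bar>G $$ (0,i)\<bar>"
        by (metis linear)
      \<comment> \<open>With this sign the new entry in column \<open>i\<close> has absolute value
        \<open>\<bar>G $$ (0,i)\<bar> - \<bar>G $$ (0,j)\<bar>\<close>, one subtractive Euclidean
        step.\<close>
      define a where "a = - sgn (G $$ (0,i)) * sgn (G $$ (0,j))"
      let ?H = "addcol a i j G"
      have H: "?H \<in> carrier_mat k k" using G by auto
      have "(\<Sum>m<k. nat \<bar>?H $$ (0,m)\<bar>) < (\<Sum>m<k. nat \<bar>G $$ (0,m)\<bar>)"
      proof (rule sum_strict_mono_ex1)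
        have less: "nat \<bar>?H $$ (0,i)\<bar> < nat \<bar>G $$ (0,i)\<bar>"
          using ij le G Suc by (auto simp: a_def sgn_if split: if_splits)
        show "\<forall>m\<in>{..<k}. nat \<bar>?H $$ (0,m)\<bar> \<le> nat \<bar>G $$ (0,m)\<bar>"
        proof
          fix m assume "m \<in> {..<k}"
          then show "nat \<bar>?H $$ (0,m)\<bar> \<le> nat \<bar>G $$ (0,m)\<bar>"
            using less G Suc by (cases "m = i") auto
        qed
        show "\<exists>m\<in>{..<k}. nat \<bar>?H $$ (0,m)\<bar> < nat \<bar>G $$ (0,m)\<bar>" using less ij by blast
      qed simp
      moreover have "det ?H = det G" by (rule det_addcol[OF ij(2,3) G])
      ultimately obtain R where "finite R" "int (card R) = \<bar>det G\<bar>" "coset_transversal k ?H R"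
        using IH[of k ?H] H dG by auto
      then show ?thesis using coset_transversal_addcol[OF G ij(1-3)] by blast
    next
      case False
      have block: "\<exists>R. finite R \<and> int (card R) = \<bar>det H\<bar> \<and> coset_transversal k H R"
        if H: "H \<in> carrier_mat k k" "det H \<noteq> 0" and z: "\<And>j. 0 < j \<Longrightarrow> j < k \<Longrightarrow> H $$ (0,j) = 0" for H
      proof -
        let ?D = "mat_delete H 0 0"
        have "det H = (\<Sum>j<k. H $$ (0,j) * cofactor H 0 j)"
          by (rule laplace_expansion_row[OF H(1)]) (simp add: Suc)
        also have "\<dots> = (\<Sum>j\<in>{0}. H $$ (0,j) * cofactor H 0 j)"
          by (rule sum.mono_neutral_right) (use z Suc in auto)
        finally have dH: "det H = H $$ (0,0) * det ?D" by (simp add: cofactor_def)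
        have "?D \<in> carrier_mat l l" using H(1) Suc by (simp add: mat_delete_def)
        then obtain R where R: "finite R" "int (card R) = \<bar>det ?D\<bar>" "coset_transversal l ?D R"
          using IH[of l ?D] dH H(2) Suc by auto
        let ?R = "(\<lambda>(a,y). vCons a y) ` ({0..<\<bar>H $$ (0,0)\<bar>} \<times> R)"
        have "coset_transversal k H ?R"
          unfolding Suc by (rule coset_transversal_block[OF _ _ refl _ R(3)]) (use H z dH Suc in auto)
        moreover have "card ?R = nat \<bar>H $$ (0,0)\<bar> * card R"
          by (subst card_image) (auto simp: inj_on_def card_cartesian_product)
        ultimately show ?thesis using R dH by (intro exI[of _ ?R]) (auto simp: abs_mult)
      qed
      obtain i where i: "i < k" "G $$ (0,i) \<noteq> 0" using lap dG by (auto elim: sum.not_neutral_contains_not_neutral)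
      show ?thesis
      proof (cases "i = 0")
        case True
        then show ?thesis using block[OF G dG] False i by auto
      next
        case nz: False
        let ?H = "swapcols 0 i G"
        have dH: "det ?H = - det G" by (rule det_swapcols[OF _ i(1) _ G]) (use Suc nz in auto)
        have "\<exists>R. finite R \<and> int (card R) = \<bar>det ?H\<bar> \<and> coset_transversal k ?H R"
          by (rule block) (use G dG dH False i nz in auto)
        then show ?thesis using coset_transversal_swapcols[OF G _ i(1), of 0] Suc dH by auto
      qed
    qed
  qed
qed

section \<open>The order of the Jacobian\<close>

text \<open>The columns in \<open>B\<close> form a square matrix with nonzero determinant by
  independence, hence determinant 1 or -1 by total unimodularity. Its inverse is integral, so the
  basis coordinates of a kernel vector depend on the others with integer coefficients; that
  integrality is the content of \<open>D\<close>.\<close>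

lemma tu_basis_kernel:
  fixes A :: "nat \<Rightarrow> 'a \<Rightarrow> int"
  assumes fin: "finite E" and tu: "totally_unimodular E r A" and B: "col_basis E r A B"
  obtains D :: "'a \<Rightarrow> 'a \<Rightarrow> int" where "\<And>x. x \<in> ker_Q E r A \<longleftrightarrow>
    (\<forall>e. e \<notin> E \<longrightarrow> x e = 0) \<and> (\<forall>b\<in>B. x b = (\<Sum>f\<in>E - B. of_int (D b f) * x f))"
proof -
  have BE: "B \<subseteq> E" and cB: "card B = r"
    and ind: "\<And>c :: 'a \<Rightarrow> rat. (\<And>i. i < r \<Longrightarrow> (\<Sum>e\<in>B. c e * of_int (A i e)) = 0) \<Longrightarrow> (\<forall>e\<in>B. c e = 0)"
    using B unfolding col_basis_def by auto
  have finB: "finite B" using BE fin finite_subset by blast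
  obtain bs where bs: "set bs = B" "distinct bs" using finite_distinct_list[OF finB] by blast
  have len: "length bs = r" using distinct_card[OF bs(2)] bs(1) cB by simp
  have bij: "bij_betw ((!) bs) {0..<r} B" using bij_betw_nth[OF bs(2)] len bs(1) by (simp add: atLeast0LessThan)
  define ix where "ix = inv_into {0..<r} ((!) bs)"
  have ix: "ix (bs ! j) = j" if "j < r" for j
    unfolding ix_def using bij_betw_inv_into_left[OF bij] that by simp
  have sumB: "(\<Sum>e\<in>B. g e) = (\<Sum>j\<in>{0..<r}. g (bs ! j))" for g :: "'a \<Rightarrow> 'c::comm_monoid_add"
    using sum.reindex_bij_betw[OF bij, of g] by simp
  define M where "M = mat r r (\<lambda>(i,j). A i (bs ! j))"
  have M: "M \<in> carrier_mat r r" by (simp add: M_def)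
  have "det (mat (length [0..<r]) (length [0..<r]) (\<lambda>(a,b). A ([0..<r] ! a) (bs ! b))) \<in> {-1, 0, 1}"
    using tu[unfolded totally_unimodular_def, rule_format, of "[0..<r]" bs] bs len BE
    by (auto simp: atLeast0LessThan)
  moreover have "mat (length [0..<r]) (length [0..<r]) (\<lambda>(a,b). A ([0..<r] ! a) (bs ! b)) = M"
    by (intro eq_matI) (auto simp: M_def)
  ultimately have dM: "det M \<in> {-1, 0, 1}" by simp
  have "det M \<noteq> 0"
  proof
    assume "det M = 0"
    then obtain v where v: "v \<in> carrier_vec r" "v \<noteq> 0\<^sub>v r" "M *\<^sub>v v = 0\<^sub>v r"
      using det_0_iff_vec_prod_zero[OF M] by blast
    define c :: "'a \<Rightarrow> rat" where "c e = of_int (v $ ix e)" for e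
    have "(\<Sum>e\<in>B. c e * of_int (A i e)) = 0" if i: "i < r" for i
    proof -
      have "(\<Sum>e\<in>B. c e * of_int (A i e)) = of_int (\<Sum>j\<in>{0..<r}. A i (bs ! j) * v $ j)"
        unfolding sumB c_def by (simp add: ix mult.commute)
      also have "(\<Sum>j\<in>{0..<r}. A i (bs ! j) * v $ j) = (M *\<^sub>v v) $ i"
        using v(1) i by (simp add: M_def scalar_prod_def)
      finally show ?thesis using v(3) i by simp
    qed
    then have "\<forall>e\<in>B. c e = 0" by (rule ind)
    then have "v $ j = 0" if "j < r" for j
      using that ix[OF that] bij_betwE[OF bij] unfolding c_def by force
    then show False using v(1,2) by (auto intro!: eq_vecI)
  qed
  then have d2: "det M * det M = 1" using dM by auto
  \<comment> \<open>Since \<open>det M\<close> is its own inverse, \<open>det M\<close> times the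
    adjugate is the inverse of \<open>M\<close>. So \<open>y f\<close> expands column
    \<open>f\<close> in the columns of \<open>B\<close>, with integer coordinates.\<close>
  define y where "y f = det M \<cdot>\<^sub>v (adj_mat M *\<^sub>v vec r (\<lambda>i. A i f))" for f
  have adj: "adj_mat M \<in> carrier_mat r r" "M * adj_mat M = det M \<cdot>\<^sub>m 1\<^sub>m r" using adj_mat[OF M] by auto
  have yc: "y f \<in> carrier_vec r" for f using adj by (simp add: y_def)
  have My: "M *\<^sub>v y f = vec r (\<lambda>i. A i f)" for f
  proof -
    let ?t = "vec r (\<lambda>i. A i f)"
    have "M *\<^sub>v y f = det M \<cdot>\<^sub>v (M *\<^sub>v (adj_mat M *\<^sub>v ?t))"
      unfolding y_def
      by (intro eq_vecI) (use M adj(1) in \<open>simp_all add: scalar_prod_def sum_distrib_left mult_ac\<close>)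
    also have "M *\<^sub>v (adj_mat M *\<^sub>v ?t) = (M * adj_mat M) *\<^sub>v ?t"
      by (rule assoc_mult_mat_vec[OF M adj(1), symmetric]) simp
    also have "\<dots> = det M \<cdot>\<^sub>v ?t" unfolding adj(2)
      by (intro eq_vecI) (auto simp: scalar_prod_def sum_distrib_left if_distrib if_distribR sum.delta cong: if_cong)
    also have "det M \<cdot>\<^sub>v (det M \<cdot>\<^sub>v ?t) = ?t"
      using d2 by (intro eq_vecI) (auto simp flip: mult.assoc)
    finally show ?thesis .
  qed
  \<comment> \<open>The sign comes from moving the columns outside \<open>B\<close> to the other
    side of the kernel equation.\<close>
  define D where "D b f = - (y f $ ix b)" for b f
  have key: "(\<Sum>b\<in>B. of_int (A i b) * of_int (D b f)) = - (of_int (A i f) :: rat)" if i: "i < r" for i f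
  proof -
    have "(\<Sum>b\<in>B. of_int (A i b) * of_int (D b f)) = (- of_int (\<Sum>j\<in>{0..<r}. A i (bs ! j) * y f $ j) :: rat)"
      unfolding sumB D_def by (simp add: ix sum_negf)
    also have "(\<Sum>j\<in>{0..<r}. A i (bs ! j) * y f $ j) = (M *\<^sub>v y f) $ i"
      using yc[of f] i by (simp add: M_def scalar_prod_def)
    finally show ?thesis using My i by simp
  qed
  \<comment> \<open>With every other column expanded in the columns of \<open>B\<close>, a kernel
    equation becomes a dependency of those columns, and its coefficients are the defects of the
    desired formula.\<close>
  have dec: "(\<Sum>e\<in>E. of_int (A i e) * x e) = (\<Sum>b\<in>B. (x b - (\<Sum>f\<in>E - B. of_int (D b f) * x f)) * of_int (A i b))"
    if i: "i < r" for i and x :: "'a \<Rightarrow> rat"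
  proof -
    have "(\<Sum>b\<in>B. (\<Sum>f\<in>E - B. of_int (D b f) * x f) * of_int (A i b)) =
        (\<Sum>b\<in>B. \<Sum>f\<in>E - B. of_int (D b f) * x f * of_int (A i b))" by (simp add: sum_distrib_right)
    also have "\<dots> = (\<Sum>f\<in>E - B. \<Sum>b\<in>B. of_int (D b f) * x f * of_int (A i b))" by (rule sum.swap)
    also have "\<dots> = (\<Sum>f\<in>E - B. (\<Sum>b\<in>B. of_int (A i b) * of_int (D b f)) * x f)"
      by (simp add: sum_distrib_left mult_ac)
    also have "\<dots> = - (\<Sum>f\<in>E - B. of_int (A i f) * x f)" by (simp add: key[OF i] sum_negf)
    finally have 1: "(\<Sum>b\<in>B. (\<Sum>f\<in>E - B. of_int (D b f) * x f) * of_int (A i b)) =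
       - (\<Sum>f\<in>E - B. of_int (A i f) * x f)" .
    have "(\<Sum>e\<in>E. of_int (A i e) * x e) = (\<Sum>f\<in>E - B. of_int (A i f) * x f) + (\<Sum>b\<in>B. of_int (A i b) * x b)"
      by (rule sum.subset_diff[OF BE fin])
    then show ?thesis using 1 by (simp add: algebra_simps sum_subtractf)
  qed
  show thesis
  proof (rule that)
    fix x :: "'a \<Rightarrow> rat"
    have "(\<forall>i<r. (\<Sum>e\<in>E. of_int (A i e) * x e) = 0) \<longleftrightarrow> (\<forall>b\<in>B. x b = (\<Sum>f\<in>E - B. of_int (D b f) * x f))"
    proof
      assume "\<forall>i<r. (\<Sum>e\<in>E. of_int (A i e) * x e) = 0"
      then have "\<forall>b\<in>B. x b - (\<Sum>f\<in>E - B. of_int (D b f) * x f) = 0" by (intro ind) (simp add: dec)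
      then show "\<forall>b\<in>B. x b = (\<Sum>f\<in>E - B. of_int (D b f) * x f)" by simp
    qed (simp add: dec)
    then show "x \<in> ker_Q E r A \<longleftrightarrow>
      (\<forall>e. e \<notin> E \<longrightarrow> x e = 0) \<and> (\<forall>b\<in>B. x b = (\<Sum>f\<in>E - B. of_int (D b f) * x f))"
      by (simp add: ker_Q_def)
  qed
qed

text \<open>The vectors \<open>U i\<close> form a \<open>\<int>\<close>-basis of the lattice \<open>ker A \<inter> \<int>\<^sup>E\<close>, dual to the coordinates \<open>js i\<close>.\<close>

locale kernel_frame =
  fixes E :: "'a set" and r :: nat and A :: "nat \<Rightarrow> 'a \<Rightarrow> int"
    and k :: nat and js :: "nat \<Rightarrow> 'a" and U :: "nat \<Rightarrow> 'a \<Rightarrow> int"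
  assumes fin: "finite E"
    and U_js: "i < k \<Longrightarrow> j < k \<Longrightarrow> U i (js j) = (if i = j then 1 else 0)"
    and ker_iff: "x \<in> ker_Q E r A \<longleftrightarrow> x = (\<lambda>e. \<Sum>i<k. x (js i) * of_int (U i e))"

text \<open>\<open>U i\<close> is the signed fundamental circuit of \<open>js i\<close> with respect
  to \<open>B\<close>: it is 1 at \<open>js i\<close>, 0 at the other elements outside
  \<open>B\<close>, and dictated by \<open>D\<close> on \<open>B\<close>.\<close>

lemma tu_basis_frame:
  fixes A :: "nat \<Rightarrow> 'a \<Rightarrow> int"
  assumes fin: "finite E" and tu: "totally_unimodular E r A" and B: "col_basis E r A B"
    and js: "bij_betw js {0..<k} (E - B)"
  shows "\<exists>U. kernel_frame E r A k js U"
proof -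
  obtain D :: "'a \<Rightarrow> 'a \<Rightarrow> int" where D: "\<And>x. x \<in> ker_Q E r A \<longleftrightarrow>
    (\<forall>e. e \<notin> E \<longrightarrow> x e = 0) \<and> (\<forall>b\<in>B. x b = (\<Sum>f\<in>E - B. of_int (D b f) * x f))"
    using tu_basis_kernel[OF fin tu B] by blast
  have BE: "B \<subseteq> E" using B by (simp add: col_basis_def)
  define U where "U i e = (if e \<in> B then D e (js i) else if e = js i then 1 else 0)" for i e
  have jsF: "js i \<in> E - B" if "i < k" for i using js that by (auto simp: bij_betw_def)
  have inj: "js i = js j \<longleftrightarrow> i = j" if "i < k" "j < k" for i j
    using js that by (auto simp: bij_betw_def inj_on_def)
  have "kernel_frame E r A k js U"
  proof
    show "finite E" by (rule fin)
    show "U i (js j) = (if i = j then 1 else 0)" if "i < k" "j < k" for i j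
      using that jsF inj by (auto simp: U_def)
    fix x :: "'a \<Rightarrow> rat"
    have b: "(\<Sum>i<k. x (js i) * of_int (U i e)) = (\<Sum>f\<in>E - B. of_int (D e f) * x f)" if "e \<in> B" for e
      using that sum.reindex_bij_betw[OF js, of "\<lambda>f. of_int (D e f) * x f"]
      by (simp add: U_def mult.commute lessThan_atLeast0)
    have f: "(\<Sum>i<k. x (js i) * of_int (U i e)) = x e" if e: "e \<in> E - B" for e
    proof -
      have "e \<in> js ` {0..<k}" using js e by (simp add: bij_betw_def)
      then obtain j where j: "j < k" "e = js j" by auto
      have "(\<Sum>i<k. x (js i) * of_int (U i e)) = (\<Sum>i<k. if i = j then x e else 0)"
        using e j inj by (intro sum.cong) (auto simp: U_def)
      then show ?thesis using j by simp
    qed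
    have o: "(\<Sum>i<k. x (js i) * of_int (U i e)) = 0" if "e \<notin> E" for e
      using that jsF BE by (intro sum.neutral) (auto simp: U_def)
    show "x \<in> ker_Q E r A \<longleftrightarrow> x = (\<lambda>e. \<Sum>i<k. x (js i) * of_int (U i e))"
    proof
      assume x: "x \<in> ker_Q E r A"
      show "x = (\<lambda>e. \<Sum>i<k. x (js i) * of_int (U i e))"
      proof
        fix e
        consider "e \<in> B" | "e \<in> E - B" | "e \<notin> E" by blast
        then show "x e = (\<Sum>i<k. x (js i) * of_int (U i e))"
        proof cases
          case 1 then show ?thesis using x b unfolding D by simp
        next
          case 2 then show ?thesis using f by simp
        next
          case 3 then show ?thesis using x o unfolding D by simp
        qed
      qed
    next
      assume "x = (\<lambda>e. \<Sum>i<k. x (js i) * of_int (U i e))"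
      then have "x e = (\<Sum>i<k. x (js i) * of_int (U i e))" for e by (rule fun_cong)
      then show "x \<in> ker_Q E r A" unfolding D using trans[OF _ b] trans[OF _ o] by blast
    qed
  qed
  then show ?thesis by blast
qed

section \<open>The Gram matrix of the lattice basis and the order of the Jacobian\<close>

context kernel_frame
begin

definition comb :: "(nat \<Rightarrow> rat) \<Rightarrow> 'a \<Rightarrow> rat" where
  "comb a e = (\<Sum>i<k. a i * of_int (U i e))"

definition ip :: "('a \<Rightarrow> rat) \<Rightarrow> nat \<Rightarrow> rat" where
  "ip x i = (\<Sum>e\<in>E. x e * of_int (U i e))"

definition gram :: "int mat" where
  "gram = mat k k (\<lambda>(i,j). \<Sum>e\<in>E. U i e * U j e)"

lemma gram_carrier: "gram \<in> carrier_mat k k" by (simp add: gram_def)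

lemma comb_js: "i < k \<Longrightarrow> comb a (js i) = a i"
  by (simp add: comb_def U_js if_distrib sum.delta cong: if_cong)

lemma comb_ker: "comb a \<in> ker_Q E r A"
proof -
  have "(\<lambda>e. \<Sum>i<k. comb a (js i) * of_int (U i e)) = comb a"
    by (auto simp: comb_js fun_eq_iff) (simp add: comb_def)
  then show ?thesis unfolding ker_iff by simp
qed

lemma ker_comb: "x \<in> ker_Q E r A \<Longrightarrow> x = comb (\<lambda>i. x (js i))"
  unfolding ker_iff comb_def by blast

lemma ker_diff: "x \<in> ker_Q E r A \<Longrightarrow> y \<in> ker_Q E r A \<Longrightarrow> x - y \<in> ker_Q E r A"
  by (simp add: ker_Q_def right_diff_distrib sum_subtractf)

text \<open>The vectors \<open>U i\<close> are integral, so integrality of the \<open>k\<close> free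
  coordinates spreads to all coordinates.\<close>

lemma Lambda_iff: "x \<in> lattice_Lambda E r A \<longleftrightarrow> x \<in> ker_Q E r A \<and> (\<forall>i<k. x (js i) \<in> \<int>)"
proof (intro iffI)
  assume x: "x \<in> ker_Q E r A \<and> (\<forall>i<k. x (js i) \<in> \<int>)"
  then have "comb (\<lambda>i. x (js i)) e \<in> \<int>" for e unfolding comb_def by (intro Ints_sum Ints_mult) auto
  then show "x \<in> lattice_Lambda E r A" using ker_comb[of x] x by (auto simp: lattice_Lambda_def)
qed (auto simp: lattice_Lambda_def)

lemma Lambda_diff: "x \<in> lattice_Lambda E r A \<Longrightarrow> y \<in> lattice_Lambda E r A \<Longrightarrow> x - y \<in> lattice_Lambda E r A"
  by (auto simp: lattice_Lambda_def intro: ker_diff)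

lemma inner_comb: "(\<Sum>e\<in>E. x e * comb b e) = (\<Sum>i<k. b i * ip x i)"
proof -
  have "(\<Sum>e\<in>E. x e * comb b e) = (\<Sum>e\<in>E. \<Sum>i<k. b i * (x e * of_int (U i e)))"
    by (simp add: comb_def sum_distrib_left mult_ac)
  also have "\<dots> = (\<Sum>i<k. \<Sum>e\<in>E. b i * (x e * of_int (U i e)))" by (rule sum.swap)
  finally show ?thesis by (simp add: ip_def sum_distrib_left)
qed

lemma dual_iff: "x \<in> lattice_dual E r A \<longleftrightarrow> x \<in> ker_Q E r A \<and> (\<forall>i<k. ip x i \<in> \<int>)"
proof (intro iffI conjI allI impI)
  assume x: "x \<in> lattice_dual E r A"
  then show "x \<in> ker_Q E r A" by (simp add: lattice_dual_def)
  fix i assume i: "i < k"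
  \<comment> \<open>This is \<open>U i\<close> itself, written as a kernel vector; testing a dual
    vector against it gives \<open>ip x i\<close>.\<close>
  let ?y = "comb (\<lambda>j. if j = i then 1 else 0)"
  have "?y \<in> lattice_Lambda E r A" by (simp add: Lambda_iff comb_ker comb_js)
  then have "(\<Sum>e\<in>E. x e * ?y e) \<in> \<int>" using x by (simp add: lattice_dual_def)
  moreover have "(\<Sum>e\<in>E. x e * ?y e) = (\<Sum>j<k. if j = i then ip x i else 0)"
    unfolding inner_comb by (intro sum.cong) auto
  ultimately show "ip x i \<in> \<int>" using i by simp
next
  assume x: "x \<in> ker_Q E r A \<and> (\<forall>i<k. ip x i \<in> \<int>)"
  have "(\<Sum>e\<in>E. x e * y e) \<in> \<int>" if y: "y \<in> lattice_Lambda E r A" for y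
  proof -
    have "y = comb (\<lambda>i. y (js i))" using y ker_comb by (simp add: Lambda_iff)
    then have "(\<Sum>e\<in>E. x e * y e) = (\<Sum>i<k. y (js i) * ip x i)" using inner_comb by metis
    also have "\<dots> \<in> \<int>" using x y by (intro Ints_sum Ints_mult) (auto simp: Lambda_iff)
    finally show ?thesis .
  qed
  then show "x \<in> lattice_dual E r A" using x by (simp add: lattice_dual_def)
qed

lemma ip_diff: "ip (x - y) i = ip x i - ip y i"
  by (simp add: ip_def left_diff_distrib sum_subtractf)

lemma ip_comb: "i < k \<Longrightarrow> ip (comb a) i = (\<Sum>j<k. of_int (gram $$ (i,j)) * a j)"
proof -
  assume i: "i < k"
  have "ip (comb a) i = (\<Sum>e\<in>E. \<Sum>j<k. of_int (U i e) * of_int (U j e) * a j)"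
    by (simp add: ip_def comb_def sum_distrib_left mult_ac)
  also have "\<dots> = (\<Sum>j<k. \<Sum>e\<in>E. of_int (U i e) * of_int (U j e) * a j)" by (rule sum.swap)
  also have "\<dots> = (\<Sum>j<k. of_int (gram $$ (i,j)) * a j)"
    using i by (simp add: gram_def sum_distrib_right)
  finally show ?thesis .
qed

lemma ip_comb_vec:
  "i < k \<Longrightarrow> y \<in> carrier_vec k \<Longrightarrow> ip (comb (\<lambda>j. of_int (y $ j))) i = of_int ((gram *\<^sub>v y) $ i)"
proof -
  assume i: "i < k" and y: "y \<in> carrier_vec k"
  have "ip (comb (\<lambda>j. of_int (y $ j))) i = (\<Sum>j<k. of_int (gram $$ (i,j)) * of_int (y $ j))"
    by (rule ip_comb[OF i])
  also have "\<dots> = of_int (\<Sum>j\<in>{0..<k}. gram $$ (i,j) * y $ j)" by (simp add: lessThan_atLeast0)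
  also have "(\<Sum>j\<in>{0..<k}. gram $$ (i,j) * y $ j) = (gram *\<^sub>v y) $ i"
    using i y gram_carrier by (simp add: scalar_prod_def)
  finally show ?thesis .
qed

text \<open>Positive definiteness: the difference lies in the span of the \<open>U i\<close> and is
  orthogonal to each of them, hence to itself.\<close>

lemma ip_inject:
  assumes x: "x \<in> ker_Q E r A" "y \<in> ker_Q E r A" and eq: "\<And>i. i < k \<Longrightarrow> ip x i = ip y i"
  shows "x = y"
proof -
  let ?d = "x - y"
  have d: "?d \<in> ker_Q E r A" using x by (rule ker_diff)
  have "(\<Sum>e\<in>E. ?d e * ?d e) = (\<Sum>i<k. ?d (js i) * ip ?d i)"
    using inner_comb[of ?d "\<lambda>i. ?d (js i)"] ker_comb[OF d] by metis
  also have "\<dots> = 0" by (simp add: ip_diff eq)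
  finally have "\<forall>e\<in>E. ?d e = 0" using fin by (subst (asm) sum_nonneg_eq_0_iff) auto
  moreover have "\<forall>e. e \<notin> E \<longrightarrow> ?d e = 0" using d unfolding ker_Q_def by blast
  ultimately show ?thesis by (metis eq_iff_diff_eq_0 ext minus_apply)
qed

lemma card_jac_set_gram:
  assumes det: "det gram \<noteq> 0"
  shows "int (card (jac_set E r A)) = \<bar>det gram\<bar>"
proof -
  let ?L = "lattice_Lambda E r A" and ?L' = "lattice_dual E r A"
  let ?Q = "{(x, y). x \<in> ?L' \<and> y \<in> ?L' \<and> x - y \<in> ?L}"
  obtain R where R: "finite R" "int (card R) = \<bar>det gram\<bar>" "coset_transversal k gram R"
    using coset_transversal_exists[OF gram_carrier det] by blast
  have RC: "x \<in> carrier_vec k" if "x \<in> R" for x using R(3) that by (auto simp: coset_transversal_def)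
  have Rex: "\<exists>!x. x \<in> R \<and> (\<exists>y\<in>carrier_vec k. z = x + gram *\<^sub>v y)" if "z \<in> carrier_vec k" for z
    using R(3) that by (auto simp: coset_transversal_def)
  have adj: "adj_mat gram \<in> carrier_mat k k" "gram * adj_mat gram = det gram \<cdot>\<^sub>m 1\<^sub>m k"
    using adj_mat[OF gram_carrier] by auto
  \<comment> \<open>Cramer's rule solves the Gram system over the rationals: \<open>\<psi> z\<close>
    is the kernel vector whose pairings with the \<open>U i\<close> are the entries of
    \<open>z\<close>. It lies in the dual lattice but need not be integral.\<close>
  define \<psi> where "\<psi> z = comb (\<lambda>i. of_int ((adj_mat gram *\<^sub>v z) $ i) / of_int (det gram))" for z
  have \<psi>_ker: "\<psi> z \<in> ker_Q E r A" for z by (simp add: \<psi>_def comb_ker)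
  have \<psi>_ip: "ip (\<psi> z) i = of_int (z $ i)" if i: "i < k" and z: "z \<in> carrier_vec k" for z i
  proof -
    let ?w = "adj_mat gram *\<^sub>v z"
    have w: "?w \<in> carrier_vec k" using adj z by simp
    have "ip (\<psi> z) i = ip (comb (\<lambda>i. of_int (?w $ i))) i / of_int (det gram)"
      using i by (simp add: \<psi>_def ip_comb sum_divide_distrib)
    also have "ip (comb (\<lambda>i. of_int (?w $ i))) i = of_int ((gram *\<^sub>v ?w) $ i)" by (rule ip_comb_vec[OF i w])
    also have "gram *\<^sub>v ?w = (gram * adj_mat gram) *\<^sub>v z"
      by (rule assoc_mult_mat_vec[OF gram_carrier adj(1) z, symmetric])
    also have "\<dots> $ i = det gram * z $ i"
      unfolding adj(2) using i z by (simp add: scalar_prod_def if_distrib if_distribR sum.delta cong: if_cong)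
    finally show ?thesis using det by simp
  qed
  have \<psi>_dual: "\<psi> z \<in> ?L'" if "z \<in> carrier_vec k" for z using \<psi>_ker \<psi>_ip that by (simp add: dual_iff)
  have L0: "(\<lambda>_. 0) \<in> ?L" by (simp add: lattice_Lambda_def ker_Q_def)
  have equiv: "equiv ?L' ?Q"
  proof (rule equivI)
    show "?Q \<subseteq> ?L' \<times> ?L'" by auto
    have "x - x = (\<lambda>_. 0)" for x :: "'a \<Rightarrow> rat" by auto
    then show "refl_on ?L' ?Q" using L0 by (auto simp: refl_on_def)
    show "sym ?Q"
    proof (rule symI)
      fix x y assume "(x, y) \<in> ?Q"
      moreover have "(\<lambda>_. 0) - (x - y) = y - x" by auto
      ultimately show "(y, x) \<in> ?Q" using Lambda_diff[OF L0, of "x - y"] by auto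
    qed
    show "trans ?Q"
    proof (rule transI)
      fix x y z assume "(x, y) \<in> ?Q" "(y, z) \<in> ?Q"
      then have m: "x - y \<in> ?L" "y - z \<in> ?L" "x \<in> ?L'" "z \<in> ?L'" by auto
      have "(x - y) - ((\<lambda>_. 0) - (y - z)) \<in> ?L" by (intro Lambda_diff m L0)
      moreover have "(x - y) - ((\<lambda>_. 0) - (y - z)) = x - z" by auto
      ultimately show "(x, z) \<in> ?Q" using m by simp
    qed
  qed
  \<comment> \<open>Congruence modulo \<open>?L\<close> turns into congruence of the pairings modulo
    the column lattice of \<open>gram\<close>, so the transversal \<open>R\<close> can be carried
    over to the Jacobian.\<close>
  have key: "x - \<psi> z \<in> ?L \<longleftrightarrow> (\<exists>y\<in>carrier_vec k. \<forall>i<k. ip x i = of_int ((z + gram *\<^sub>v y) $ i))"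
    if x: "x \<in> ?L'" and z: "z \<in> carrier_vec k" for x z
  proof
    assume L: "x - \<psi> z \<in> ?L"
    define y where "y = vec k (\<lambda>i. \<lfloor>(x - \<psi> z) (js i)\<rfloor>)"
    have y: "y \<in> carrier_vec k" by (simp add: y_def)
    have yi: "of_int (y $ i) = (x - \<psi> z) (js i)" if "i < k" for i
      using L that by (simp add: Lambda_iff y_def of_int_floor_cancel flip: minus_apply)
    have "x - \<psi> z = comb (\<lambda>i. of_int (y $ i))"
    proof -
      have "comb (\<lambda>i. of_int (y $ i)) = comb (\<lambda>i. (x - \<psi> z) (js i))"
        unfolding comb_def by (intro ext sum.cong) (simp_all add: yi)
      then show ?thesis using L ker_comb[of "x - \<psi> z"] by (simp add: Lambda_iff)
    qed
    then have "ip x i = of_int ((z + gram *\<^sub>v y) $ i)" if "i < k" for i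
      using ip_diff[of x "\<psi> z" i] \<psi>_ip[OF that z] ip_comb_vec[OF that y] that gram_carrier by simp
    then show "\<exists>y\<in>carrier_vec k. \<forall>i<k. ip x i = of_int ((z + gram *\<^sub>v y) $ i)" using y by blast
  next
    assume "\<exists>y\<in>carrier_vec k. \<forall>i<k. ip x i = of_int ((z + gram *\<^sub>v y) $ i)"
    then obtain y where y: "y \<in> carrier_vec k" "\<And>i. i < k \<Longrightarrow> ip x i = of_int ((z + gram *\<^sub>v y) $ i)" by blast
    have "x - \<psi> z = comb (\<lambda>i. of_int (y $ i))"
    proof (rule ip_inject)
      show "x - \<psi> z \<in> ker_Q E r A" using x \<psi>_ker by (auto simp: dual_iff intro: ker_diff)
      show "ip (x - \<psi> z) i = ip (comb (\<lambda>i. of_int (y $ i))) i" if "i < k" for i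
        using y that gram_carrier by (simp add: ip_diff \<psi>_ip[OF that z] ip_comb_vec)
    qed (rule comb_ker)
    then show "x - \<psi> z \<in> ?L" by (simp add: Lambda_iff comb_ker comb_js)
  qed
  have "bij_betw (\<lambda>z. ?Q `` {\<psi> z}) R (jac_set E r A)"
  proof (rule bij_betw_imageI)
    show "inj_on (\<lambda>z. ?Q `` {\<psi> z}) R"
    proof (rule inj_onI)
      fix z z' assume z: "z \<in> R" "z' \<in> R" and "?Q `` {\<psi> z} = ?Q `` {\<psi> z'}"
      then have "\<psi> z - \<psi> z' \<in> ?L"
        using eq_equiv_class_iff[OF equiv \<psi>_dual \<psi>_dual] RC by auto
      then obtain y where y: "y \<in> carrier_vec k" "\<And>i. i < k \<Longrightarrow> ip (\<psi> z) i = of_int ((z' + gram *\<^sub>v y) $ i)"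
        using key \<psi>_dual RC z by blast
      then have "z = z' + gram *\<^sub>v y"
      proof (intro eq_vecI)
        fix i assume "i < dim_vec (z' + gram *\<^sub>v y)"
        then have i: "i < k" using gram_carrier by simp
        have "rat_of_int (z $ i) = of_int ((z' + gram *\<^sub>v y) $ i)"
          using y(2)[OF i] \<psi>_ip[OF i RC[OF z(1)]] by simp
        then show "z $ i = (z' + gram *\<^sub>v y) $ i" by (simp only: of_int_eq_iff)
      qed (use RC[OF z(1)] gram_carrier in simp)
      moreover have "z = z + gram *\<^sub>v 0\<^sub>v k"
        using RC[OF z(1)] gram_carrier by (intro eq_vecI) auto
      ultimately show "z = z'" using Rex[OF RC[OF z(1)]] z y(1) zero_carrier_vec by blast
    qed
    show "(\<lambda>z. ?Q `` {\<psi> z}) ` R = jac_set E r A"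
    proof
      show "(\<lambda>z. ?Q `` {\<psi> z}) ` R \<subseteq> jac_set E r A"
        unfolding jac_set_def by (intro image_subsetI quotientI \<psi>_dual RC)
      show "jac_set E r A \<subseteq> (\<lambda>z. ?Q `` {\<psi> z}) ` R"
      proof
        fix c assume "c \<in> jac_set E r A"
        then obtain x where x: "x \<in> ?L'" "c = ?Q `` {x}" unfolding jac_set_def by (blast elim: quotientE)
        \<comment> \<open>On the dual lattice these pairings are already integers; the floor only
          changes the type.\<close>
        define t where "t = vec k (\<lambda>i. \<lfloor>ip x i\<rfloor>)"
        have ti: "of_int (t $ i) = ip x i" if "i < k" for i
          using x that by (simp add: t_def dual_iff of_int_floor_cancel)
        have "t \<in> carrier_vec k" by (simp add: t_def)
        then obtain z y where z: "z \<in> R" "y \<in> carrier_vec k" "t = z + gram *\<^sub>v y" using Rex by blast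
        then have "\<forall>i<k. ip x i = of_int ((z + gram *\<^sub>v y) $ i)" using ti by auto
        then have "x - \<psi> z \<in> ?L" using key[OF x(1) RC[OF z(1)]] z(2) by blast
        then have "(x, \<psi> z) \<in> ?Q" using x \<psi>_dual RC z by auto
        then have "?Q `` {x} = ?Q `` {\<psi> z}" by (rule equiv_class_eq[OF equiv])
        then show "c \<in> (\<lambda>z. ?Q `` {\<psi> z}) ` R" using x z by blast
      qed
    qed
  qed
  then have "card R = card (jac_set E r A)" by (rule bij_betw_same_card)
  then show ?thesis using R(2) by simp
qed

text \<open>A dependency among the columns in \<open>E - S\<close> is a nonzero kernel vector
  vanishing on \<open>S\<close>. Its coordinates in the basis \<open>U\<close> are then a nonzero
  null vector of the transposed minor.\<close>

lemma minor_not_basis: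
  assumes S: "S \<subseteq> E" "card (E - S) = r" and en: "bij_betw en {0..<k} S"
    and nb: "\<not> col_basis E r A (E - S)"
  shows "det (mat k k (\<lambda>(i,j). U i (en j))) = 0"
proof (rule ccontr)
  assume nz: "det (mat k k (\<lambda>(i,j). U i (en j))) \<noteq> 0"
  let ?M = "mat k k (\<lambda>(i,j). rat_of_int (U j (en i)))"
  have "?M = transpose_mat (map_mat rat_of_int (mat k k (\<lambda>(i,j). U i (en j))))" by auto
  then have "det ?M = det (map_mat rat_of_int (mat k k (\<lambda>(i,j). U i (en j))))"
    by (simp add: det_transpose[of _ k])
  also have "\<dots> = rat_of_int (det (mat k k (\<lambda>(i,j). U i (en j))))" by (rule of_int_hom.hom_det)
  finally have dM: "det ?M \<noteq> 0" using nz by simp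
  obtain c :: "'a \<Rightarrow> rat" where c: "\<And>i. i < r \<Longrightarrow> (\<Sum>e\<in>E - S. c e * of_int (A i e)) = 0" "\<exists>e\<in>E - S. c e \<noteq> 0"
    using nb S by (auto simp: col_basis_def)
  define x where "x e = (if e \<in> E - S then c e else 0)" for e
  have "(\<Sum>e\<in>E. of_int (A i e) * x e) = 0" if i: "i < r" for i
  proof -
    have "(\<Sum>e\<in>E. of_int (A i e) * x e) = (\<Sum>e\<in>E - S. of_int (A i e) * x e)"
      using fin by (intro sum.mono_neutral_right) (auto simp: x_def)
    also have "\<dots> = (\<Sum>e\<in>E - S. c e * of_int (A i e))" by (intro sum.cong) (auto simp: x_def)
    finally show ?thesis using c(1)[OF i] by simp
  qed
  then have xk: "x \<in> ker_Q E r A" by (simp add: ker_Q_def x_def)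
  let ?v = "vec k (\<lambda>i. x (js i))"
  have "?M *\<^sub>v ?v = 0\<^sub>v k"
  proof (rule eq_vecI)
    fix j assume "j < dim_vec (0\<^sub>v k :: rat vec)"
    then have j: "j < k" by simp
    have "(?M *\<^sub>v ?v) $ j = comb (\<lambda>i. x (js i)) (en j)"
      using j by (simp add: scalar_prod_def comb_def lessThan_atLeast0 mult.commute)
    also have "\<dots> = x (en j)" using ker_comb[OF xk] by metis
    also have "\<dots> = 0" using bij_betwE[OF en] j by (simp add: x_def)
    finally show "(?M *\<^sub>v ?v) $ j = 0\<^sub>v k $ j" using j by simp
  qed simp
  then have "?v = 0\<^sub>v k" using dM det_0_iff_vec_prod_zero_field[of ?M k] vec_carrier mat_carrier by metis
  then have "x (js i) = 0" if "i < k" for i using that by (metis index_vec index_zero_vec(1))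
  then have "x = (\<lambda>e. 0)" using ker_comb[OF xk] by (simp add: comb_def fun_eq_iff)
  then show False using c(2) by (auto simp: x_def fun_eq_iff split: if_splits)
qed

text \<open>The bases of the lattice attached to two matroid bases differ by a matrix in \<open>GL\<^sub>k(\<int>)\<close>.\<close>

lemma minor_basis:
  assumes tu: "totally_unimodular E r A"
    and en: "bij_betw en {0..<k} S" and S: "S \<subseteq> E" and B: "col_basis E r A (E - S)"
  shows "det (mat k k (\<lambda>(i,j). U i (en j))) * det (mat k k (\<lambda>(i,j). U i (en j))) = 1"
proof -
  have "E - (E - S) = S" using S by blast
  then obtain V where "kernel_frame E r A k en V" using tu_basis_frame[OF fin tu B, of en k] en by auto
  then interpret V: kernel_frame E r A k en V .
  let ?N = "mat k k (\<lambda>(i,j). U i (en j))" and ?P = "mat k k (\<lambda>(i,j). V i (js j))"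
  \<comment> \<open>Expand \<open>V i\<close> in the \<open>U m\<close>, with coefficients
    \<open>V i (js m)\<close>, and evaluate at \<open>en j\<close>, where the vectors
    \<open>V i\<close> form the identity matrix.\<close>
  have "?P * ?N = 1\<^sub>m k"
  proof (rule eq_matI)
    fix i j assume "i < dim_row (1\<^sub>m k :: int mat)" "j < dim_col (1\<^sub>m k :: int mat)"
    then have ij: "i < k" "j < k" by auto
    let ?x = "V.comb (\<lambda>m. if m = i then 1 else 0)"
    have x: "?x e = of_int (V i e)" for e
      unfolding V.comb_def using ij by (simp add: if_distrib if_distribR sum.delta cong: if_cong)
    have "?x (en j) = comb (\<lambda>m. ?x (js m)) (en j)" using ker_comb[OF V.comb_ker] by metis
    then have "rat_of_int (V i (en j)) = of_int (\<Sum>m<k. V i (js m) * U m (en j))"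
      unfolding x comb_def by simp
    then have "V i (en j) = (\<Sum>m<k. V i (js m) * U m (en j))" by (simp only: of_int_eq_iff)
    then show "(?P * ?N) $$ (i,j) = 1\<^sub>m k $$ (i,j)"
      using ij V.U_js[OF ij] by (simp add: scalar_prod_def lessThan_atLeast0)
  qed auto
  then have "det ?P * det ?N = 1" using det_mult[of ?P k ?N] by simp
  then have "det ?N = 1 \<or> det ?N = - 1" unfolding zmult_eq_1_iff by blast
  then show ?thesis by (elim disjE) simp_all
qed

lemma det_gram:
  assumes tu: "totally_unimodular E r A" and k: "k + r = card E"
  shows "det gram = int (card {B. col_basis E r A B})"
proof -
  have "\<exists>h. bij_betw h {0..<k} S" if "S \<subseteq> E" "card S = k" for S
    using ex_bij_betw_nat_finite[of S] finite_subset[OF that(1) fin] that(2) by auto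
  then obtain en where en: "\<And>S. S \<subseteq> E \<Longrightarrow> card S = k \<Longrightarrow> bij_betw (en S) {0..<k} S" by metis
  let ?S = "{S. S \<subseteq> E \<and> card S = k}"
  have cc: "card (E - S) = r" if "S \<subseteq> E" "card S = k" for S
    using card_Diff_subset[OF finite_subset[OF that(1) fin] that(1)] that k by simp
  have "det gram = (\<Sum>S\<in>?S. det (mat k k (\<lambda>(i,j). U i (en S j))) * det (mat k k (\<lambda>(i,j). U i (en S j))))"
    unfolding gram_def by (rule Cauchy_Binet[OF fin en])
  also have "\<dots> = (\<Sum>S\<in>?S. if col_basis E r A (E - S) then 1 else 0)"
  proof (rule sum.cong[OF refl])
    fix S assume "S \<in> ?S"
    then have S: "S \<subseteq> E" "card S = k" by auto
    show "det (mat k k (\<lambda>(i,j). U i (en S j))) * det (mat k k (\<lambda>(i,j). U i (en S j))) =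
       (if col_basis E r A (E - S) then 1 else 0)"
      using minor_basis[OF tu en[OF S] S(1)] minor_not_basis[OF S(1) cc[OF S] en[OF S]] by auto
  qed
  also have "\<dots> = int (card {S\<in>?S. col_basis E r A (E - S)})"
    using fin by (simp add: sum.If_cases Int_def)
  also have "card {S\<in>?S. col_basis E r A (E - S)} = card {B. col_basis E r A B}"
  proof (rule bij_betw_same_card[of "\<lambda>S. E - S"], rule bij_betw_byWitness[where f' = "\<lambda>B. E - B"])
    show "(\<lambda>B. E - B) ` {B. col_basis E r A B} \<subseteq> {S\<in>?S. col_basis E r A (E - S)}"
    proof safe
      fix B assume B: "col_basis E r A B"
      then have BE: "B \<subseteq> E" "card B = r" by (auto simp: col_basis_def)
      then show "card (E - B) = k" using card_Diff_subset[OF finite_subset[OF BE(1) fin] BE(1)] k by simp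
      show "col_basis E r A (E - (E - B))" using B BE by (simp add: double_diff)
    qed
  qed (auto simp: col_basis_def)
  finally show ?thesis .
qed

end

theorem card_jac_set:
  assumes fin: "finite E" and tu: "totally_unimodular E r A" and B: "col_basis E r A B"
  shows "card (jac_set E r A) = card {B. col_basis E r A B}"
proof -
  have BE: "B \<subseteq> E" "card B = r" using B by (auto simp: col_basis_def)
  define k where "k = card (E - B)"
  have k: "k + r = card E"
    unfolding k_def using BE fin by (metis card_Diff_subset card_mono finite_subset le_add_diff_inverse2)
  obtain js where "bij_betw js {0..<k} (E - B)"
    using ex_bij_betw_nat_finite[of "E - B"] fin by (auto simp: k_def)
  then obtain U where "kernel_frame E r A k js U" using tu_basis_frame[OF fin tu B] by blast
  then interpret kernel_frame E r A k js U .
  have "finite {B. col_basis E r A B}"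
    by (rule finite_subset[of _ "Pow E"]) (use fin in \<open>auto simp: col_basis_def\<close>)
  \<comment> \<open>\<open>B\<close> is one of the bases counted by the determinant, so the Gram
    matrix is nonsingular and the coset count applies.\<close>
  then have "det gram > 0" using B by (auto simp: det_gram[OF tu k] card_gt_0_iff)
  then show ?thesis using card_jac_set_gram det_gram[OF tu k] by simp
qed

corollary jac_card_eq_card_bases:
  assumes "finite E" "\<B> \<noteq> {}" "tu_rep E \<B> r A"
  shows "jac_card E \<B> = card \<B>"
proof -
  have card: "card (jac_set E r A) = card \<B>" if "tu_rep E \<B> r A" for r A
    using that assms(1,2) card_jac_set[OF assms(1)] unfolding tu_rep_def by blast
  show ?thesis unfolding jac_card_def
    by (rule some_equality) (use assms(3) card in metis)+
qed

section \<open>A totally unimodular representation of the metric matroid\<close>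

lemma independent_columns_card_le:
  fixes A :: "nat \<Rightarrow> 'a \<Rightarrow> int"
  assumes fin: "finite S"
    and ind: "\<And>c :: 'a \<Rightarrow> rat. (\<And>i. i < r \<Longrightarrow> (\<Sum>e\<in>S. c e * of_int (A i e)) = 0) \<Longrightarrow> (\<forall>e\<in>S. c e = 0)"
  shows "card S \<le> r"
proof (rule ccontr)
  assume "\<not> card S \<le> r"
  then have r: "r < card S" by simp
  define n where "n = card S"
  obtain h where h: "bij_betw h {0..<n} S" using ex_bij_betw_nat_finite[OF fin] by (auto simp: n_def)
  \<comment> \<open>Zero rows pad the coefficient matrix to a square one. Row \<open>r\<close> is
    such a row because \<open>r < n\<close>, so the determinant vanishes and an integer dependency
    results.\<close>
  let ?M = "mat n n (\<lambda>(i,j). if i < r then A i (h j) else 0)"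
  have "det ?M = (\<Sum>j<n. ?M $$ (r,j) * cofactor ?M r j)"
    by (rule laplace_expansion_row) (use r in \<open>auto simp: n_def\<close>)
  also have "\<dots> = 0" using r by (intro sum.neutral) (auto simp: n_def)
  finally obtain v where v: "v \<in> carrier_vec n" "v \<noteq> 0\<^sub>v n" "?M *\<^sub>v v = 0\<^sub>v n"
    using det_0_iff_vec_prod_zero[of ?M n] by auto
  define c :: "'a \<Rightarrow> rat" where "c e = of_int (v $ inv_into {0..<n} h e)" for e
  have ch: "c (h j) = of_int (v $ j)" if "j < n" for j
    using bij_betw_inv_into_left[OF h] that by (simp add: c_def)
  have "(\<Sum>e\<in>S. c e * of_int (A i e)) = 0" if i: "i < r" for i
  proof -
    have "(\<Sum>e\<in>S. c e * of_int (A i e)) = (\<Sum>j\<in>{0..<n}. c (h j) * of_int (A i (h j)))"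
      by (rule sum.reindex_bij_betw[OF h, symmetric])
    also have "\<dots> = of_int (\<Sum>j\<in>{0..<n}. A i (h j) * v $ j)" by (simp add: ch mult.commute)
    also have "(\<Sum>j\<in>{0..<n}. A i (h j) * v $ j) = (?M *\<^sub>v v) $ i"
      using v(1) i r by (simp add: scalar_prod_def n_def)
    also have "\<dots> = 0" unfolding v(3) using i r by (simp add: n_def)
    finally show ?thesis by simp
  qed
  then have "\<forall>e\<in>S. c e = 0" by (rule ind)
  then have "v $ j = 0" if "j < n" for j using ch[OF that] bij_betwE[OF h] that by auto
  then show False using v(1,2) by (auto intro!: eq_vecI)
qed

text \<open>With injections in place of lists, deleting a row or a column is composition with
  \<open>insert_index\<close>, which suits an induction on the size of a submatrix.\<close>

lemma totally_unimodular_iff_inj: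
  "totally_unimodular E r A \<longleftrightarrow> (\<forall>n f h. inj_on f {..<n} \<longrightarrow> inj_on h {..<n} \<longrightarrow> f ` {..<n} \<subseteq> {..<r} \<longrightarrow>
     h ` {..<n} \<subseteq> E \<longrightarrow> det (mat n n (\<lambda>(a,b). A (f a) (h b))) \<in> {-1, 0, 1})"
proof (intro iffI allI impI)
  fix n f and h :: "nat \<Rightarrow> 'a"
  assume tu: "totally_unimodular E r A" and *: "inj_on f {..<n}" "inj_on h {..<n}" "f ` {..<n} \<subseteq> {..<r}" "h ` {..<n} \<subseteq> E"
  let ?is = "map f [0..<n]" and ?js = "map h [0..<n]"
  have "det (mat (length ?is) (length ?is) (\<lambda>(a,b). A (?is ! a) (?js ! b))) \<in> {-1, 0, 1}"
    by (rule tu[unfolded totally_unimodular_def, rule_format])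
      (use * in \<open>auto simp: distinct_map lessThan_atLeast0\<close>)
  moreover have "mat (length ?is) (length ?is) (\<lambda>(a,b). A (?is ! a) (?js ! b)) = mat n n (\<lambda>(a,b). A (f a) (h b))"
    by (intro eq_matI) auto
  ultimately show "det (mat n n (\<lambda>(a,b). A (f a) (h b))) \<in> {-1, 0, 1}" by simp
next
  assume *: "\<forall>n f h. inj_on f {..<n} \<longrightarrow> inj_on h {..<n} \<longrightarrow> f ` {..<n} \<subseteq> {..<r} \<longrightarrow>
     h ` {..<n} \<subseteq> E \<longrightarrow> det (mat n n (\<lambda>(a,b). A (f a) (h b))) \<in> {-1, 0, 1}"
  show "totally_unimodular E r A" unfolding totally_unimodular_def
  proof (intro allI impI, elim conjE)
    fix "is" js assume "distinct is" "distinct js" "length is = length js" "set is \<subseteq> {..<r}" "set js \<subseteq> E"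
    then show "det (mat (length is) (length is) (\<lambda>(a,b). A (is ! a) (js ! b))) \<in> {-1, 0, 1}"
      using *[rule_format, of "(!) is" "length is" "(!) js"]
      by (force simp: inj_on_nth subset_iff in_set_conv_nth)
  qed
qed

lemma det_unit_column:
  fixes M :: "int mat"
  assumes M: "M \<in> carrier_mat n n" and ij: "i < n" "j < n"
    and z: "\<And>a. a < n \<Longrightarrow> a \<noteq> i \<Longrightarrow> M $$ (a,j) = 0" and e: "M $$ (i,j) \<in> {-1, 0, 1}"
    and d: "det (mat_delete M i j) \<in> {-1, 0, 1}"
  shows "det M \<in> {-1, 0, 1}"
proof -
  have "det M = (\<Sum>a<n. M $$ (a,j) * cofactor M a j)" by (rule laplace_expansion_column[OF M ij(2)])
  also have "\<dots> = (\<Sum>a\<in>{i}. M $$ (a,j) * cofactor M a j)"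
    by (rule sum.mono_neutral_right) (use ij z in auto)
  finally have "det M = M $$ (i,j) * ((-1)^(i+j) * det (mat_delete M i j))" by (simp add: cofactor_def)
  moreover have "(-1::int)^(i+j) \<in> {-1, 1}" by (cases "even (i+j)") auto
  ultimately show ?thesis using e d by auto
qed

lemma det_unit_row:
  fixes M :: "int mat"
  assumes M: "M \<in> carrier_mat n n" and ij: "i < n" "j < n"
    and z: "\<And>b. b < n \<Longrightarrow> b \<noteq> j \<Longrightarrow> M $$ (i,b) = 0" and e: "M $$ (i,j) \<in> {-1, 0, 1}"
    and d: "det (mat_delete M i j) \<in> {-1, 0, 1}"
  shows "det M \<in> {-1, 0, 1}"
proof -
  have "det M = (\<Sum>b<n. M $$ (i,b) * cofactor M i b)" by (rule laplace_expansion_row[OF M ij(1)])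
  also have "\<dots> = (\<Sum>b\<in>{j}. M $$ (i,b) * cofactor M i b)"
    by (rule sum.mono_neutral_right) (use ij z in auto)
  finally have "det M = M $$ (i,j) * ((-1)^(i+j) * det (mat_delete M i j))" by (simp add: cofactor_def)
  moreover have "(-1::int)^(i+j) \<in> {-1, 1}" by (cases "even (i+j)") auto
  ultimately show ?thesis using e d by auto
qed

text \<open>Extra rows force the coordinates of a kernel vector to be constant on every fibre \<open>E\<^sub>e\<close>.\<close>

definition series_matrix :: "nat \<Rightarrow> (nat \<Rightarrow> 'a \<Rightarrow> int) \<Rightarrow> (nat \<Rightarrow> 'a \<times> nat) \<Rightarrow> nat \<Rightarrow> 'a \<times> nat \<Rightarrow> int" where
  "series_matrix r A g q u =
    (if q < r then (if snd u = 0 then A q (fst u) else 0)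
     else if u = g (q - r) then 1 else if u = (fst (g (q - r)), 0) then -1 else 0)"

lemma finite_metric_ground:
  assumes "finite E"
  shows "finite (metric_ground E w)"
proof -
  have "metric_ground E w = Sigma E (\<lambda>e. {..<w e})" by (auto simp: metric_ground_def)
  then show ?thesis using assms by simp
qed

text \<open>\<open>g\<close> numbers the \<open>K\<close> elements other than the
  \<open>(e, 0)\<close>. Each of them brings one extra row, so the rank is to grow from
  \<open>r\<close> to \<open>r + K\<close>.\<close>

locale metric_matroid =
  fixes E :: "'a set" and r :: nat and A :: "nat \<Rightarrow> 'a \<Rightarrow> int" and w :: "'a \<Rightarrow> nat"
    and K :: nat and g :: "nat \<Rightarrow> 'a \<times> nat"
  assumes fin: "finite E" and w: "e \<in> E \<Longrightarrow> 1 \<le> w e"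
    and g: "bij_betw g {0..<K} (metric_ground E w - E \<times> {0})"
begin

abbreviation "G \<equiv> metric_ground E w"
abbreviation "A' \<equiv> series_matrix r A g"

lemma finite_ground: "finite G"
  by (rule finite_metric_ground[OF fin])

lemma zero_ground: "E \<times> {0} \<subseteq> G" using w by (auto simp: metric_ground_def Suc_le_eq)

lemma card_ground: "card G = card E + K"
proof -
  have "card (G - E \<times> {0}) = K" using bij_betw_same_card[OF g] by simp
  moreover have "card (G - E \<times> {0}) = card G - card E"
    using fin zero_ground by (subst card_Diff_subset) (auto simp: card_cartesian_product)
  moreover have "card E \<le> card G"
    using card_mono[OF finite_ground zero_ground] by (simp add: card_cartesian_product)
  ultimately show ?thesis by simp
qed

lemma g_in: "m < K \<Longrightarrow> g m \<in> G \<and> fst (g m) \<in> E \<and> snd (g m) \<noteq> 0"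
  using bij_betwE[OF g] by (cases "g m") (force simp: metric_ground_def)

lemma g_inj: "m < K \<Longrightarrow> m' < K \<Longrightarrow> g m = g m' \<longleftrightarrow> m = m'"
  using g by (auto simp: bij_betw_def inj_on_def)

lemma g_surj: "(e, i) \<in> G \<Longrightarrow> i \<noteq> 0 \<Longrightarrow> \<exists>m<K. g m = (e, i)"
proof -
  assume "(e, i) \<in> G" "i \<noteq> 0"
  then have "(e, i) \<in> g ` {0..<K}" using g by (auto simp: bij_betw_def)
  then show ?thesis by auto
qed

text \<open>A column of some \<open>(e, i)\<close> with \<open>i \<noteq> 0\<close> has at most one
  nonzero entry, the 1 in its own extra row. Without such columns an extra row keeps at most the -1
  at \<open>(e, 0)\<close>. Either line allows a Laplace expansion with a single term; if neither
  occurs, the submatrix comes from \<open>A\<close>.\<close>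

lemma totally_unimodular_series:
  assumes tu: "totally_unimodular E r A"
  shows "totally_unimodular G (r + K) A'"
  unfolding totally_unimodular_iff_inj
proof (intro allI impI)
  fix n :: nat and f h
  assume "inj_on f {..<n}" "inj_on h {..<n}" "f ` {..<n} \<subseteq> {..<r + K}" "h ` {..<n} \<subseteq> G"
  then show "det (mat n n (\<lambda>(a,b). A' (f a) (h b))) \<in> {-1, 0, 1}"
  proof (induction n arbitrary: f h)
    case 0
    then show ?case by simp
  next
    case (Suc n)
    let ?M = "mat (Suc n) (Suc n) (\<lambda>(a,b). A' (f a) (h b))"
    have fi: "f a = f b \<longleftrightarrow> a = b" if "a < Suc n" "b < Suc n" for a b
      using Suc.prems(1) that by (auto simp: inj_on_def)
    have hi: "h a = h b \<longleftrightarrow> a = b" if "a < Suc n" "b < Suc n" for a b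
      using Suc.prems(2) that by (auto simp: inj_on_def)
    have fr: "f a < r + K" if "a < Suc n" for a using Suc.prems(3) that by auto
    have hr: "h a \<in> G" if "a < Suc n" for a using Suc.prems(4) that by auto
    have del: "det (mat_delete ?M i j) \<in> {-1, 0, 1}" if ij: "i < Suc n" "j < Suc n" for i j
    proof -
      have "mat_delete ?M i j = mat n n (\<lambda>(a,b). A' ((f \<circ> insert_index i) a) ((h \<circ> insert_index j) b))"
        using ij by (intro eq_matI) (auto simp: mat_delete_def insert_index_def)
      moreover have "det (mat n n (\<lambda>(a,b). A' ((f \<circ> insert_index i) a) ((h \<circ> insert_index j) b))) \<in> {-1, 0, 1}"
      proof (rule Suc.IH)
        show "inj_on (f \<circ> insert_index i) {..<n}" using fi
          by (auto simp: inj_on_def insert_index_def split: if_splits)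
        show "inj_on (h \<circ> insert_index j) {..<n}" using hi
          by (auto simp: inj_on_def insert_index_def split: if_splits)
        show "(f \<circ> insert_index i) ` {..<n} \<subseteq> {..<r + K}" using fr by (auto simp: insert_index_def)
        show "(h \<circ> insert_index j) ` {..<n} \<subseteq> G" using hr by (auto simp: insert_index_def)
      qed
      ultimately show ?thesis by simp
    qed
    have M: "?M \<in> carrier_mat (Suc n) (Suc n)" by simp
    consider b where "b < Suc n" "snd (h b) \<noteq> 0" | a where "\<forall>b<Suc n. snd (h b) = 0" "a < Suc n" "r \<le> f a"
      | "\<forall>b<Suc n. snd (h b) = 0" "\<forall>a<Suc n. f a < r" by (meson not_le)
    then show ?case
    proof cases
      case 1
      have ent: "A' (f a) (h b) = (if r \<le> f a \<and> h b = g (f a - r) then 1 else 0)" for a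
        using 1 by (auto simp: series_matrix_def)
      obtain i where i: "i < Suc n" "\<And>a. a < Suc n \<Longrightarrow> a \<noteq> i \<Longrightarrow> A' (f a) (h b) = 0"
      proof (cases "\<exists>i<Suc n. r \<le> f i \<and> h b = g (f i - r)")
        case True
        then obtain i where i: "i < Suc n" "r \<le> f i" "h b = g (f i - r)" by blast
        have "A' (f a) (h b) = 0" if a: "a < Suc n" "a \<noteq> i" for a
        proof (rule ccontr)
          assume "A' (f a) (h b) \<noteq> 0"
          then have "r \<le> f a" "g (f a - r) = g (f i - r)" using ent i by (auto split: if_splits)
          then have "f a = f i" using g_inj[of "f a - r" "f i - r"] fr[OF a(1)] fr[OF i(1)] i(2) by simp
          then show False using fi a i by blast
        qed
        then show thesis using that i by blast
      next
        case False
        \<comment> \<open>The whole column vanishes in this submatrix, so the expansion may use any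
          row.\<close>
        then show thesis using that[of 0] ent by auto
      qed
      show ?thesis
        by (rule det_unit_column[OF M i(1) 1(1)]) (use i 1 ent del in auto)
    next
      case (2 a)
      have ent: "A' (f a) (h b) = (if h b = (fst (g (f a - r)), 0) then - 1 else 0)" if "b < Suc n" for b
      proof -
        have "f a - r < K" using fr[OF 2(2)] 2(3) by auto
        then have "snd (g (f a - r)) \<noteq> 0" using g_in by blast
        then have "h b \<noteq> g (f a - r)" using 2(1) that by metis
        then show ?thesis using 2(3) by (simp add: series_matrix_def)
      qed
      obtain j where j: "j < Suc n" "\<And>b. b < Suc n \<Longrightarrow> b \<noteq> j \<Longrightarrow> A' (f a) (h b) = 0"
      proof (cases "\<exists>j<Suc n. h j = (fst (g (f a - r)), 0)")
        case True
        then obtain j where "j < Suc n" "h j = (fst (g (f a - r)), 0)" by blast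
        then show thesis using that[of j] ent hi by metis
      next
        case False
        then show thesis using that[of 0] ent by auto
      qed
      show ?thesis
        by (rule det_unit_row[OF M 2(2) j(1)]) (use j 2 ent del in auto)
    next
      case 3
      have "?M = mat (Suc n) (Suc n) (\<lambda>(a,b). A (f a) ((fst \<circ> h) b))"
        using 3 by (intro eq_matI) (auto simp: series_matrix_def)
      moreover have "det (mat (Suc n) (Suc n) (\<lambda>(a,b). A (f a) ((fst \<circ> h) b))) \<in> {-1, 0, 1}"
      proof (rule tu[unfolded totally_unimodular_iff_inj, rule_format])
        show "inj_on f {..<Suc n}" by (rule Suc.prems)
        show "inj_on (fst \<circ> h) {..<Suc n}" using 3 hi by (force simp: inj_on_def prod_eq_iff)
        show "f ` {..<Suc n} \<subseteq> {..<r}" using 3 by auto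
        show "(fst \<circ> h) ` {..<Suc n} \<subseteq> E" using hr by (force simp: metric_ground_def)
      qed
      ultimately show ?thesis by simp
    qed
  qed
qed

lemma series_row_old:
  fixes x :: "'a \<times> nat \<Rightarrow> rat"
  assumes "q < r"
  shows "(\<Sum>u\<in>G. x u * of_int (A' q u)) = (\<Sum>e\<in>E. x (e, 0) * of_int (A q e))"
proof -
  have "(\<Sum>u\<in>G. x u * of_int (A' q u)) = (\<Sum>u\<in>E \<times> {0}. x u * of_int (A' q u))"
    using finite_ground zero_ground assms
    by (intro sum.mono_neutral_right) (auto simp: series_matrix_def metric_ground_def)
  also have "\<dots> = (\<Sum>e\<in>E. x (e, 0) * of_int (A q e))"
    using assms by (intro sum.reindex_bij_witness[of _ "\<lambda>e. (e, 0)" fst]) (auto simp: series_matrix_def)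
  finally show ?thesis .
qed

lemma series_row_new:
  fixes x :: "'a \<times> nat \<Rightarrow> rat"
  assumes m: "m < K"
  shows "(\<Sum>u\<in>G. x u * of_int (A' (r + m) u)) = x (g m) - x (fst (g m), 0)"
proof -
  let ?v = "(fst (g m), 0)"
  have g: "g m \<in> G" "?v \<in> G" "g m \<noteq> ?v" using g_in[OF m] zero_ground by (auto simp: prod_eq_iff)
  have "(\<Sum>u\<in>G. x u * of_int (A' (r + m) u)) = (\<Sum>u\<in>{g m, ?v}. x u * of_int (A' (r + m) u))"
    using finite_ground g by (intro sum.mono_neutral_right) (auto simp: series_matrix_def)
  also have "\<dots> = x (g m) - x ?v" using g by (auto simp: series_matrix_def)
  finally show ?thesis .
qed

text \<open>With \<open>x\<close> read as the coefficients of a column dependency, this says that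
  dependencies of the new matrix are those of \<open>A\<close> repeated along fibres. Both
  comparisons of bases below rest on it.\<close>

lemma series_kernel:
  fixes x :: "'a \<times> nat \<Rightarrow> rat"
  shows "(\<forall>q<r + K. (\<Sum>u\<in>G. x u * of_int (A' q u)) = 0) \<longleftrightarrow>
    (\<forall>i<r. (\<Sum>e\<in>E. x (e, 0) * of_int (A i e)) = 0) \<and> (\<forall>(e,i)\<in>G. x (e, i) = x (e, 0))"
proof -
  have split: "(\<forall>q<r + K. P q) \<longleftrightarrow> (\<forall>q<r. P q) \<and> (\<forall>m<K. P (r + m))" for P
  proof (intro iffI allI impI)
    fix q assume *: "(\<forall>q<r. P q) \<and> (\<forall>m<K. P (r + m))" "q < r + K"
    show "P q"
    proof (cases "q < r")
      case False
      then have "P (r + (q - r))" using * by (intro conjunct2[OF *(1), rule_format]) auto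
      then show ?thesis using False by simp
    qed (use * in blast)
  qed auto
  have "(\<forall>q<r + K. (\<Sum>u\<in>G. x u * of_int (A' q u)) = 0) \<longleftrightarrow>
    (\<forall>q<r. (\<Sum>u\<in>G. x u * of_int (A' q u)) = 0) \<and> (\<forall>m<K. (\<Sum>u\<in>G. x u * of_int (A' (r + m) u)) = 0)"
    by (rule split)
  also have "(\<forall>m<K. (\<Sum>u\<in>G. x u * of_int (A' (r + m) u)) = 0) \<longleftrightarrow> (\<forall>m<K. x (g m) = x (fst (g m), 0))"
    by (simp add: series_row_new)
  also have "\<dots> \<longleftrightarrow> (\<forall>(e,i)\<in>G. x (e, i) = x (e, 0))"
  proof (intro iffI ballI allI impI, safe)
    fix e i assume *: "\<forall>m<K. x (g m) = x (fst (g m), 0)" "(e, i) \<in> G"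
    show "x (e, i) = x (e, 0)"
    proof (cases "i = 0")
      case False
      then obtain m where "m < K" "g m = (e, i)" using g_surj *(2) by blast
      then show ?thesis using * by (metis fst_conv)
    qed simp
  next
    fix m assume *: "\<forall>(e,i)\<in>G. x (e, i) = x (e, 0)" "m < K"
    then show "x (g m) = x (fst (g m), 0)" using g_in[of m] by (cases "g m") auto
  qed
  finally show ?thesis by (simp add: series_row_old)
qed

text \<open>The column of \<open>g m\<close> meets row \<open>r + m\<close> only, which kills the
  coefficients of the extra rows; the columns \<open>(e, 0)\<close> then reduce the claim to
  \<open>A\<close>.\<close>

lemma full_row_rank_series:
  assumes fr: "full_row_rank E r A"
  shows "full_row_rank G (r + K) A'"
  unfolding full_row_rank_def
proof (rule allI, rule impI)
  fix c :: "nat \<Rightarrow> rat"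
  assume c: "\<forall>u\<in>G. (\<Sum>q<r + K. c q * of_int (A' q u)) = 0"
  have new: "c (r + m) = 0" if m: "m < K" for m
  proof -
    have "A' q (g m) = 0" if "q < r + K" "q \<noteq> r + m" for q
      using that g_in[OF m] g_inj[OF m, of "q - r"] by (auto simp: series_matrix_def prod_eq_iff)
    then have "(\<Sum>q<r + K. c q * of_int (A' q (g m))) = (\<Sum>q\<in>{r + m}. c q * of_int (A' q (g m)))"
      using m by (intro sum.mono_neutral_right) auto
    also have "\<dots> = c (r + m)" by (simp add: series_matrix_def)
    finally show ?thesis using c g_in[OF m] by simp
  qed
  have "(\<Sum>i<r. c i * of_int (A i e)) = 0" if e: "e \<in> E" for e
  proof -
    have "(\<Sum>q<r + K. c q * of_int (A' q (e, 0))) = (\<Sum>q<r. c q * of_int (A' q (e, 0)))"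
    proof (rule sum.mono_neutral_right)
      show "\<forall>q\<in>{..<r + K} - {..<r}. c q * of_int (A' q (e, 0)) = 0"
      proof
        fix q assume "q \<in> {..<r + K} - {..<r}"
        then have "q - r < K" "r + (q - r) = q" by auto
        then have "c q = 0" using new by metis
        then show "c q * of_int (A' q (e, 0)) = 0" by simp
      qed
    qed auto
    also have "\<dots> = (\<Sum>i<r. c i * of_int (A i e))" by (simp add: series_matrix_def)
    finally show ?thesis using c e zero_ground by auto
  qed
  then have "\<forall>i<r. c i = 0" using fr unfolding full_row_rank_def by blast
  moreover have "c q = 0" if "r \<le> q" "q < r + K" for q using new[of "q - r"] that by simp
  ultimately show "\<forall>q<r + K. c q = 0" by (meson not_le)
qed

text \<open>Coefficients on \<open>B\<close> extended by zero are kernel vectors vanishing off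
  \<open>B\<close>, so independence can be tested on fibrewise constant vectors.\<close>

lemma col_basis_series_iff:
  "col_basis G (r + K) A' B \<longleftrightarrow> B \<subseteq> G \<and> card B = r + K \<and>
     (\<forall>x :: 'a \<times> nat \<Rightarrow> rat. (\<forall>u\<in>G - B. x u = 0) \<longrightarrow> (\<forall>i<r. (\<Sum>e\<in>E. x (e, 0) * of_int (A i e)) = 0) \<longrightarrow>
       (\<forall>(e,i)\<in>G. x (e, i) = x (e, 0)) \<longrightarrow> (\<forall>u\<in>B. x u = 0))" (is "_ \<longleftrightarrow> _ \<and> _ \<and> ?R")
proof -
  have eqv: "(\<forall>c :: 'a \<times> nat \<Rightarrow> rat. (\<forall>q<r + K. (\<Sum>u\<in>B. c u * of_int (A' q u)) = 0) \<longrightarrow> (\<forall>u\<in>B. c u = 0)) \<longleftrightarrow> ?R"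
    if B: "B \<subseteq> G"
  proof -
    have s: "(\<Sum>u\<in>G. x u * of_int (A' q u)) = (\<Sum>u\<in>B. x u * of_int (A' q u))"
      if "\<forall>u\<in>G - B. x u = 0" for x :: "'a \<times> nat \<Rightarrow> rat" and q
      using that B finite_ground by (intro sum.mono_neutral_right) auto
    show ?thesis
    proof (intro iffI allI impI)
      fix x :: "'a \<times> nat \<Rightarrow> rat"
      assume *: "\<forall>c :: 'a \<times> nat \<Rightarrow> rat. (\<forall>q<r + K. (\<Sum>u\<in>B. c u * of_int (A' q u)) = 0) \<longrightarrow> (\<forall>u\<in>B. c u = 0)"
        "\<forall>u\<in>G - B. x u = 0" "\<forall>i<r. (\<Sum>e\<in>E. x (e, 0) * of_int (A i e)) = 0" "\<forall>(e,i)\<in>G. x (e, i) = x (e, 0)"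
      have "\<forall>q<r + K. (\<Sum>u\<in>G. x u * of_int (A' q u)) = 0" unfolding series_kernel using * by blast
      then show "\<forall>u\<in>B. x u = 0" using s[OF *(2)] *(1) by simp
    next
      fix c :: "'a \<times> nat \<Rightarrow> rat"
      assume *: ?R "\<forall>q<r + K. (\<Sum>u\<in>B. c u * of_int (A' q u)) = 0"
      define x where "x u = (if u \<in> B then c u else 0)" for u
      have x0: "\<forall>u\<in>G - B. x u = 0" by (simp add: x_def)
      have "(\<Sum>u\<in>B. x u * of_int (A' q u)) = (\<Sum>u\<in>B. c u * of_int (A' q u))" for q
        by (intro sum.cong) (auto simp: x_def)
      then have "\<forall>q<r + K. (\<Sum>u\<in>G. x u * of_int (A' q u)) = 0" using s[OF x0] *(2) by simp
      then have "\<forall>u\<in>B. x u = 0" using *(1) x0 unfolding series_kernel by blast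
      then show "\<forall>u\<in>B. c u = 0" by (simp add: x_def)
    qed
  qed
  show ?thesis unfolding col_basis_def
    by (rule conj_cong[OF refl], rule conj_cong[OF refl], rule eqv)
qed

text \<open>A fibrewise constant dependency that vanishes at the removed point
  \<open>(e, x e)\<close> vanishes on the whole fibre of \<open>e\<close>. What survives lives over
  \<open>B'\<close>, where the columns of \<open>A\<close> are independent.\<close>

lemma col_basis_series_of_basis:
  assumes B': "col_basis E r A B'" and x: "\<forall>e\<in>E - B'. x e < w e"
  shows "col_basis G (r + K) A' (G - (\<lambda>e. (e, x e)) ` (E - B'))"
proof -
  define C where "C = (\<lambda>e. (e, x e)) ` (E - B')"
  have BE: "B' \<subseteq> E" "card B' = r" using B' by (auto simp: col_basis_def)
  have CG: "C \<subseteq> G" using x by (auto simp: C_def metric_ground_def)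
  have "card C = card (E - B')" unfolding C_def by (rule card_image) (simp add: inj_on_def)
  also have "\<dots> = card E - r" using BE fin by (metis card_Diff_subset finite_subset)
  finally have "card (G - C) = card G - (card E - r)"
    using card_Diff_subset[OF finite_subset[OF CG finite_ground] CG] by simp
  moreover have "r \<le> card E" using BE fin card_mono by blast
  ultimately have card: "card (G - C) = r + K" by (simp add: card_ground)
  have "\<forall>u\<in>G - C. y u = 0"
    if y: "\<forall>u\<in>G - (G - C). y u = 0" "\<forall>i<r. (\<Sum>e\<in>E. y (e, 0) * of_int (A i e)) = 0"
    "\<forall>(e,i)\<in>G. y (e, i) = y (e, 0)" for y :: "'a \<times> nat \<Rightarrow> rat"
  proof -
    have out: "y (e, 0) = 0" if "e \<in> E - B'" for e
    proof -
      have "(e, x e) \<in> C" "(e, x e) \<in> G" using that CG by (auto simp: C_def)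
      then have "y (e, x e) = 0" "y (e, x e) = y (e, 0)" using y(1,3) by auto
      then show ?thesis by simp
    qed
    have "(\<Sum>e\<in>B'. y (e, 0) * of_int (A i e)) = (\<Sum>e\<in>E. y (e, 0) * of_int (A i e))" for i
      using BE fin out by (intro sum.mono_neutral_left) auto
    then have "\<forall>i<r. (\<Sum>e\<in>B'. y (e, 0) * of_int (A i e)) = 0" using y(2) by simp
    then have "\<forall>e\<in>B'. y (e, 0) = 0"
      using B'[unfolded col_basis_def, THEN conjunct2, THEN conjunct2, rule_format, of "\<lambda>e. y (e, 0)"] by blast
    then have "y (e, 0) = 0" if "e \<in> E" for e using out that by blast
    then show ?thesis using y(3) by (auto simp: metric_ground_def)
  qed
  then show ?thesis unfolding C_def[symmetric] col_basis_series_iff using card by blast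
qed

text \<open>\<open>T\<close> collects the elements whose fibre loses a point. A dependency of
  \<open>A\<close> on \<open>E - T\<close> lifts to one supported in \<open>B\<close>, so
  \<open>E - T\<close> has at most \<open>r\<close> elements; and \<open>T\<close> has at most
  \<open>card E - r\<close>, the number of lost points. Both bounds must be equalities, so
  \<open>E - T\<close> is a basis and each fibre over \<open>T\<close> loses exactly one
  point.\<close>

lemma basis_of_col_basis_series:
  assumes B: "col_basis G (r + K) A' B" and rE: "r \<le> card E"
  shows "\<exists>B' x. col_basis E r A B' \<and> (\<forall>e\<in>E - B'. x e < w e) \<and> B = G - (\<lambda>e. (e, x e)) ` (E - B')"
proof -
  have BG: "B \<subseteq> G" "card B = r + K"
    and ind: "\<And>x :: 'a \<times> nat \<Rightarrow> rat. \<lbrakk>\<forall>u\<in>G - B. x u = 0; \<forall>i<r. (\<Sum>e\<in>E. x (e, 0) * of_int (A i e)) = 0;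
       \<forall>(e,i)\<in>G. x (e, i) = x (e, 0)\<rbrakk> \<Longrightarrow> \<forall>u\<in>B. x u = 0"
    using B unfolding col_basis_series_iff by auto
  let ?C = "G - B"
  define T where "T = fst ` ?C"
  have TE: "T \<subseteq> E" by (auto simp: T_def metric_ground_def)
  have finC: "finite ?C" using finite_ground by simp
  have cC: "card ?C = card E - r"
    using card_Diff_subset[OF finite_subset[OF BG(1) finite_ground] BG(1)] BG(2) card_ground by simp
  have indT: "\<forall>e\<in>E - T. c e = 0" if c: "\<And>i. i < r \<Longrightarrow> (\<Sum>e\<in>E - T. c e * of_int (A i e)) = 0" for c :: "'a \<Rightarrow> rat"
  proof -
    define x where "x u = (if fst u \<in> E - T then c (fst u) else 0)" for u :: "'a \<times> nat"
    have eq: "(\<Sum>e\<in>E. x (e, 0) * of_int (A i e)) = (\<Sum>e\<in>E - T. c e * of_int (A i e))" for i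
    proof -
      have "(\<Sum>e\<in>E. x (e, 0) * of_int (A i e)) = (\<Sum>e\<in>E - T. x (e, 0) * of_int (A i e))"
        using fin by (intro sum.mono_neutral_right) (auto simp: x_def)
      also have "\<dots> = (\<Sum>e\<in>E - T. c e * of_int (A i e))" by (intro sum.cong) (auto simp: x_def)
      finally show ?thesis .
    qed
    have "\<forall>u\<in>B. x u = 0"
    proof (rule ind)
      show "\<forall>i<r. (\<Sum>e\<in>E. x (e, 0) * of_int (A i e)) = 0" using eq c by simp
    qed (auto simp: x_def T_def)
    moreover have "(e, 0) \<in> B" if "e \<in> E - T" for e
      using that zero_ground by (force simp: T_def)
    ultimately show ?thesis by (force simp: x_def)
  qed
  have "card (E - T) \<le> r" by (rule independent_columns_card_le[OF _ indT]) (use fin in auto)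
  moreover have cT: "card T \<le> card E - r" using card_image_le[OF finC, of fst] cC by (simp add: T_def)
  moreover have "card (E - T) = card E - card T" using TE fin by (metis card_Diff_subset finite_subset)
  moreover have "card T \<le> card E" using TE fin card_mono by blast
  ultimately have c: "card (E - T) = r" "card T = card ?C" using cC rE by linarith+
  have inj: "inj_on fst ?C" by (rule eq_card_imp_inj_on[OF finC]) (use c in \<open>simp add: T_def\<close>)
  define x where "x e = (SOME i. (e, i) \<in> ?C)" for e
  have x: "(e, x e) \<in> ?C" if e: "e \<in> T" for e
  proof -
    obtain u where "u \<in> ?C" "e = fst u" using e unfolding T_def by blast
    then have "(e, snd u) \<in> ?C" by simp
    then show ?thesis unfolding x_def by (rule someI)
  qed
  have "?C = (\<lambda>e. (e, x e)) ` T"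
  proof
    show "(\<lambda>e. (e, x e)) ` T \<subseteq> ?C" using x by auto
    show "?C \<subseteq> (\<lambda>e. (e, x e)) ` T"
    proof
      fix u assume u: "u \<in> ?C"
      then have t: "fst u \<in> T" by (simp add: T_def)
      have "u = (fst u, x (fst u))" using inj_onD[OF inj _ u x[OF t]] by simp
      then show "u \<in> (\<lambda>e. (e, x e)) ` T" using t by blast
    qed
  qed
  moreover have "E - (E - T) = T" using TE by blast
  moreover have "B = G - ?C" using BG by blast
  ultimately have "B = G - (\<lambda>e. (e, x e)) ` (E - (E - T))" by simp
  moreover have "col_basis E r A (E - T)" using indT c(1) by (auto simp: col_basis_def)
  moreover have "\<forall>e\<in>E - (E - T). x e < w e" using x by (auto simp: metric_ground_def)
  ultimately show ?thesis by blast
qed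

end

lemma tu_rep_metric:
  assumes fin: "finite E" and ne: "\<B> \<noteq> {}" and w: "\<forall>e\<in>E. 1 \<le> w e" and rep: "tu_rep E \<B> r A"
  shows "\<exists>r' A'. tu_rep (metric_ground E w) (metric_bases E \<B> w) r' A'"
proof -
  obtain g where "bij_betw g {0..<card (metric_ground E w - E \<times> {0})} (metric_ground E w - E \<times> {0})"
    using ex_bij_betw_nat_finite[OF finite_Diff[OF finite_metric_ground[OF fin]]] by blast
  then interpret metric_matroid E r A w "card (metric_ground E w - E \<times> {0})" g
    by unfold_locales (use fin w in auto)
  have \<B>: "\<B> = {B. col_basis E r A B}" and tu: "totally_unimodular E r A" and fr: "full_row_rank E r A"
    using rep by (auto simp: tu_rep_def)
  obtain B where "col_basis E r A B" using ne \<B> by blast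
  then have "r \<le> card E" using card_mono[OF fin, of B] by (simp add: col_basis_def)
  have im: "{(e, x e) | e. e \<in> E - B'} = (\<lambda>e. (e, x e)) ` (E - B')" for B' and x :: "'a \<Rightarrow> nat"
    by blast
  have "metric_bases E \<B> w = {B. col_basis G (r + card (G - E \<times> {0})) A' B}"
  proof (intro Set.set_eqI iffI)
    fix B assume "B \<in> metric_bases E \<B> w"
    then obtain B' x where "B' \<in> \<B>" "\<forall>e\<in>E - B'. x e < w e" "B = G - (\<lambda>e. (e, x e)) ` (E - B')"
      unfolding metric_bases_def im by blast
    then show "B \<in> {B. col_basis G (r + card (G - E \<times> {0})) A' B}"
      using col_basis_series_of_basis[of B' x] by (simp add: \<B>)
  next
    fix B assume "B \<in> {B. col_basis G (r + card (G - E \<times> {0})) A' B}"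
    then obtain B' x where "col_basis E r A B'" "\<forall>e\<in>E - B'. x e < w e" "B = G - (\<lambda>e. (e, x e)) ` (E - B')"
      using basis_of_col_basis_series[OF _ \<open>r \<le> card E\<close>] by blast
    moreover from this have "B' \<in> \<B>" by (simp add: \<B>)
    ultimately show "B \<in> metric_bases E \<B> w" unfolding metric_bases_def im by blast
  qed
  then show ?thesis using totally_unimodular_series[OF tu] full_row_rank_series[OF fr]
    unfolding tu_rep_def by blast
qed

section \<open>Counting bases\<close>

text \<open>The removed set is the graph of the choice \<open>x\<close>, and its projection recovers
  \<open>E - B\<close>. Taking \<open>x\<close> extensional makes the pair \<open>(B, x)\<close>
  unique, so no basis is counted twice.\<close>

lemma card_metric_bases:
  assumes fin: "finite E" and sub: "\<forall>B\<in>\<B>. B \<subseteq> E"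
  shows "card (metric_bases E \<B> w) = (\<Sum>B\<in>\<B>. \<Prod>e\<in>E - B. w e)"
proof -
  let ?G = "metric_ground E w"
  let ?P = "SIGMA B:\<B>. PiE (E - B) (\<lambda>e. {..<w e})"
  let ?graph = "\<lambda>(B, x). (\<lambda>e. (e, x e)) ` (E - B)"
  have fin\<B>: "finite \<B>" using fin sub by (intro finite_subset[of \<B> "Pow E"]) auto
  have graph_sub: "?graph (B, x) \<subseteq> ?G" if "(B, x) \<in> ?P" for B x
    using that by (auto simp: metric_ground_def PiE_iff)
  have inj: "inj_on (\<lambda>z. ?G - ?graph z) ?P"
  proof (rule inj_onI)
    have dd: "C \<subseteq> A \<Longrightarrow> D \<subseteq> A \<Longrightarrow> A - C = A - D \<Longrightarrow> C = D" for A C D :: "'c set" by blast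
    fix u v assume uv: "u \<in> ?P" "v \<in> ?P" and uv_eq: "?G - ?graph u = ?G - ?graph v"
    obtain B x B' x' where [simp]: "u = (B, x)" "v = (B', x')" by (cases u; cases v)
    have z: "B \<in> \<B>" "x \<in> PiE (E - B) (\<lambda>e. {..<w e})" "B' \<in> \<B>" "x' \<in> PiE (E - B') (\<lambda>e. {..<w e})"
      using uv by auto
    have "?graph (B, x) \<subseteq> ?G" "?graph (B', x') \<subseteq> ?G"
      using graph_sub[of B x] graph_sub[of B' x'] z by blast+
    then have g: "?graph (B, x) = ?graph (B', x')" using uv_eq[unfolded \<open>u = (B, x)\<close> \<open>v = (B', x')\<close>] by (rule dd)
    have "fst ` ?graph (B, x) = E - B" "fst ` ?graph (B', x') = E - B'" by (simp_all add: image_image)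
    then have "E - B = E - B'" using g by simp
    then have BB: "B = B'" using z sub by blast
    have "x e = x' e" if e: "e \<in> E - B" for e
    proof -
      have "(e, x e) \<in> ?graph (B', x')" using e g by blast
      then show ?thesis by auto
    qed
    then have "x = x'" using z BB by (intro PiE_ext[of x "E - B" _ x']) auto
    then show "u = v" using BB by simp
  qed
  have "metric_bases E \<B> w = (\<lambda>z. ?G - ?graph z) ` ?P"
  proof (intro Set.set_eqI iffI)
    fix B assume "B \<in> metric_bases E \<B> w"
    then obtain B' x where *: "B' \<in> \<B>" "\<forall>e\<in>E - B'. x e < w e" "B = ?G - {(e, x e) | e. e \<in> E - B'}"
      unfolding metric_bases_def by blast
    have "{(e, x e) | e. e \<in> E - B'} = ?graph (B', restrict x (E - B'))" by auto
    then have "B = ?G - ?graph (B', restrict x (E - B'))" using *(3) by (simp only:)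
    then show "B \<in> (\<lambda>z. ?G - ?graph z) ` ?P" by (rule image_eqI) (use * in auto)
  next
    fix B assume "B \<in> (\<lambda>z. ?G - ?graph z) ` ?P"
    then obtain z where z: "B = ?G - ?graph z" "z \<in> ?P" by (rule imageE)
    obtain B' x where "z = (B', x)" by (cases z)
    then have *: "B' \<in> \<B>" "x \<in> PiE (E - B') (\<lambda>e. {..<w e})" "B = ?G - ?graph (B', x)" using z by auto
    have "?graph (B', x) = {(e, x e) | e. e \<in> E - B'}" by auto
    moreover have "\<forall>e\<in>E - B'. x e < w e" using *(2) by (auto simp: PiE_iff)
    moreover have "B = ?G - {(e, x e) | e. e \<in> E - B'}" using *(3) calculation(1) by (simp only:)
    ultimately show "B \<in> metric_bases E \<B> w" using *(1) unfolding metric_bases_def by blast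
  qed
  then have "card (metric_bases E \<B> w) = card ?P" using inj by (simp only: card_image)
  also have "\<dots> = (\<Sum>B\<in>\<B>. card (PiE (E - B) (\<lambda>e. {..<w e})))"
    using fin fin\<B> by (intro card_SigmaI) (auto intro!: finite_PiE)
  also have "\<dots> = (\<Sum>B\<in>\<B>. \<Prod>e\<in>E - B. w e)" using fin by (simp add: card_PiE)
  finally show ?thesis .
qed

text \<open>The monomial of \<open>B\<close> has support \<open>E - B\<close>, so different bases
  never share a monomial and every coefficient is 1.\<close>

lemma mpoly_eval_config_poly:
  assumes fin: "finite E" and sub: "\<forall>B\<in>\<B>. B \<subseteq> E"
  shows "mpoly_eval (config_poly E \<B>) x = (\<Sum>B\<in>\<B>. \<Prod>e\<in>E - B. x e)"
proof -
  define M :: "'a set \<Rightarrow> 'a \<Rightarrow>\<^sub>0 nat" where "M B = (\<Sum>e\<in>E - B. Poly_Mapping.single e 1)" for B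
  have fin\<B>: "finite \<B>" using fin sub by (intro finite_subset[of \<B> "Pow E"]) auto
  have M: "Poly_Mapping.lookup (M B) e = (if e \<in> E - B then 1 else 0)" for B e
    using fin by (simp add: M_def lookup_sum lookup_single when_def)
  have keysM: "Poly_Mapping.keys (M B) = E - B" for B
    by (auto simp: in_keys_iff M split: if_splits)
  have injM: "inj_on M \<B>"
  proof (rule inj_onI)
    fix B C assume "B \<in> \<B>" "C \<in> \<B>" "M B = M C"
    then have "B \<subseteq> E" "C \<subseteq> E" "E - B = E - C" using keysM[of B] keysM[of C] sub by auto
    then show "B = C" by blast
  qed
  have look: "Poly_Mapping.lookup (config_poly E \<B>) m = (if m \<in> M ` \<B> then 1 else 0)" for m
  proof -
    have "Poly_Mapping.lookup (config_poly E \<B>) m = (\<Sum>B\<in>\<B>. if M B = m then 1 else 0)"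
      unfolding config_poly_def M_def[symmetric] by (simp add: lookup_sum lookup_single when_def eq_commute[of m])
    also have "\<dots> = (\<Sum>n\<in>M ` \<B>. if n = m then 1 else 0)"
      by (simp add: sum.reindex[OF injM])
    also have "\<dots> = (if m \<in> M ` \<B> then 1 else 0)" using fin\<B> by simp
    finally show ?thesis .
  qed
  have keys: "Poly_Mapping.keys (config_poly E \<B>) = M ` \<B>"
    by (auto simp: in_keys_iff look split: if_splits)
  have "mpoly_eval (config_poly E \<B>) x = (\<Sum>m\<in>M ` \<B>. \<Prod>e\<in>Poly_Mapping.keys m. x e ^ Poly_Mapping.lookup m e)"
    by (simp add: mpoly_eval_def keys look)
  also have "\<dots> = (\<Sum>B\<in>\<B>. \<Prod>e\<in>E - B. x e ^ Poly_Mapping.lookup (M B) e)"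
    by (simp add: sum.reindex[OF injM] keysM)
  also have "\<dots> = (\<Sum>B\<in>\<B>. \<Prod>e\<in>E - B. x e)"
    by (intro sum.cong prod.cong) (auto simp: M)
  finally show ?thesis .
qed

text \<open>Height boxes and vectors over the prime field are total functions with a fixed value off
  \<open>E\<close>; restriction identifies them with a product of finite sets.\<close>

lemma card_functions_default:
  assumes "finite E"
  shows "card {f. (\<forall>e\<in>E. f e \<in> S e) \<and> (\<forall>e. e \<notin> E \<longrightarrow> f e = d)} = (\<Prod>e\<in>E. card (S e))"
proof -
  have "bij_betw (\<lambda>f. restrict f E) {f. (\<forall>e\<in>E. f e \<in> S e) \<and> (\<forall>e. e \<notin> E \<longrightarrow> f e = d)} (PiE E S)"
    by (rule bij_betw_byWitness[where f' = "\<lambda>f e. if e \<in> E then f e else d"])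
      (auto simp: fun_eq_iff PiE_iff extensional_def)
  from bij_betw_same_card[OF this] show ?thesis using card_PiE[OF assms, of S] by simp
qed

lemma finite_functions_default:
  assumes "finite E" "\<And>e. e \<in> E \<Longrightarrow> finite (S e)"
  shows "finite {f. (\<forall>e\<in>E. f e \<in> S e) \<and> (\<forall>e. e \<notin> E \<longrightarrow> f e = d)}"
proof -
  have "{f. (\<forall>e\<in>E. f e \<in> S e) \<and> (\<forall>e. e \<notin> E \<longrightarrow> f e = d)} \<subseteq>
      (\<lambda>f e. if e \<in> E then f e else d) ` PiE E S"
  proof
    fix f assume "f \<in> {f. (\<forall>e\<in>E. f e \<in> S e) \<and> (\<forall>e. e \<notin> E \<longrightarrow> f e = d)}"
    then have "f = (\<lambda>e. if e \<in> E then restrict f E e else d)" "restrict f E \<in> PiE E S"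
      by (auto simp: fun_eq_iff)
    then show "f \<in> (\<lambda>f e. if e \<in> E then f e else d) ` PiE E S" by blast
  qed
  then show ?thesis using finite_PiE[OF assms(1), of S] assms(2) by (meson finite_imageI finite_subset)
qed

section \<open>Densities and projective points\<close>

lemma Fp_vectors_altdef:
  "Fp_vectors p E = {x. (\<forall>e\<in>E. x e \<in> {0..<int p}) \<and> (\<forall>e. e \<notin> E \<longrightarrow> x e = 0)}"
  by (auto simp: Fp_vectors_def)

lemma finite_Fp_vectors: "finite E \<Longrightarrow> finite (Fp_vectors p E)"
  unfolding Fp_vectors_altdef by (intro finite_functions_default) auto

lemma card_Fp_vectors: "finite E \<Longrightarrow> card (Fp_vectors p E) = p ^ card E"
  unfolding Fp_vectors_altdef by (subst card_functions_default) auto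

lemma zero_in_Fp_vectors: "0 < p \<Longrightarrow> (\<lambda>_. 0) \<in> Fp_vectors p E"
  by (auto simp: Fp_vectors_def)

lemma residue_class_density:
  assumes p: "0 < p" and a: "a < p"
  shows "(\<lambda>m. real (card {k\<in>{1..m}. k mod p = a}) / real m) \<longlonglongrightarrow> 1 / real p"
proof -
  define c where "c m = card {k\<in>{1..m}. k mod p = a}" for m
  have up: "c m \<le> m div p + 1" for m
  proof -
    have "c m \<le> card {0..m div p}" unfolding c_def
    proof (rule card_inj_on_le[of "\<lambda>k. k div p"])
      show "inj_on (\<lambda>k. k div p) {k\<in>{1..m}. k mod p = a}"
        by (rule inj_onI) (metis (mono_tags, lifting) div_mult_mod_eq mem_Collect_eq)
      show "(\<lambda>k. k div p) ` {k\<in>{1..m}. k mod p = a} \<subseteq> {0..m div p}" by (auto intro: div_le_mono)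
    qed auto
    then show ?thesis by simp
  qed
  have lo: "m div p \<le> c m + 1" for m
  proof -
    \<comment> \<open>Starting at 1 avoids the value 0 that \<open>j = 0\<close> gives when
      \<open>a = 0\<close>; stopping before \<open>m div p\<close> keeps \<open>j * p + a\<close> at
      most \<open>m\<close>.\<close>
    have "card {1..<m div p} \<le> c m" unfolding c_def
    proof (rule card_inj_on_le[of "\<lambda>j. j * p + a"])
      show "inj_on (\<lambda>j. j * p + a) {1..<m div p}" using p by (auto simp: inj_on_def)
      show "(\<lambda>j. j * p + a) ` {1..<m div p} \<subseteq> {k\<in>{1..m}. k mod p = a}"
      proof safe
        fix j assume j: "j \<in> {1..<m div p}"
        have "j * p + a \<le> (j + 1) * p" using a by simp
        also have "\<dots> \<le> (m div p) * p" using j by (intro mult_right_mono) auto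
        also have "\<dots> \<le> m" by simp
        finally have "j * p + a \<le> m" .
        moreover have "1 \<le> j * p" using j p by (simp add: Suc_le_eq)
        ultimately show "j * p + a \<in> {1..m}" unfolding atLeastAtMost_iff by linarith
        show "(j * p + a) mod p = a" using a by simp
      qed
    qed auto
    then show ?thesis by simp
  qed
  \<comment> \<open>Of the error 2, one unit is the slack in the count and one is the rounding in
    \<open>m div p\<close>.\<close>
  have bd: "norm (real (c m) / real m - 1 / real p) \<le> 2 / real m" if "0 < m" for m
  proof -
    have m: "m \<noteq> 0" using that by simp
    have "real (m div p) \<le> real m / real p" by (rule of_nat_div_le_of_nat)
    moreover have "real m / real p \<le> real (m div p) + 1"
    proof -
      have "m \<le> (m div p + 1) * p"
        using div_mult_mod_eq[of m p] mod_less_divisor[OF p, of m] by (simp only: distrib_right mult_1)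
      then have "real m \<le> (real (m div p) + 1) * real p"
        by (metis of_nat_1 of_nat_add of_nat_le_iff of_nat_mult)
      then show ?thesis using p by (simp add: pos_divide_le_eq)
    qed
    ultimately have "\<bar>real (c m) - real m / real p\<bar> \<le> 2" using up[of m] lo[of m] by linarith
    then have "\<bar>real (c m) - real m / real p\<bar> / real m \<le> 2 / real m" using m by (simp add: divide_right_mono)
    moreover have "\<bar>real (c m) - real m / real p\<bar> / real m = \<bar>(real (c m) - real m / real p) / real m\<bar>" by simp
    moreover have "(real (c m) - real m / real p) / real m = real (c m) / real m - 1 / real p"
      using m by (simp add: diff_divide_distrib)
    ultimately show ?thesis by simp
  qed
  have "\<forall>\<^sub>F m in sequentially. norm (real (c m) / real m - 1 / real p) \<le> norm (2 / real m) * 1"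
    by (rule eventually_mono[OF eventually_gt_at_top[of 0]]) (use bd in simp)
  then have "(\<lambda>m. real (c m) / real m - 1 / real p) \<longlonglongrightarrow> 0"
    by (rule tendsto_0_le[OF lim_const_over_n])
  then show ?thesis unfolding c_def by (rule LIM_zero_cancel)
qed

text \<open>Inside a box, the elements with prescribed residues form a product of one-dimensional
  residue classes. The ratio is thus a finite sum, over the admissible residue vectors, of products
  of factors tending to \<open>1 / p\<close>.\<close>

lemma density_ratio_periodic:
  assumes p: "0 < p" and fin: "finite E"
    and S: "\<And>w. \<forall>e\<in>E. 1 \<le> w e \<Longrightarrow> \<forall>e. e \<notin> E \<longrightarrow> w e = 0 \<Longrightarrow> w \<in> S \<longleftrightarrow> P (\<lambda>e. int (w e) mod int p)"
  shows "density_ratio E S \<longlonglongrightarrow> real (card {z\<in>Fp_vectors p E. P z}) / real (p ^ card E)"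
proof -
  let ?Z = "{z\<in>Fp_vectors p E. P z}"
  let ?c = "\<lambda>m a. card {k\<in>{1..m}. k mod p = nat a}"
  let ?res = "\<lambda>w e. int (w e) mod int p"
  have box: "height_box E m = {w. (\<forall>e\<in>E. w e \<in> {1..m}) \<and> (\<forall>e. e \<notin> E \<longrightarrow> w e = 0)}" for m
    by (auto simp: height_box_def)
  have finbox: "finite (height_box E m)" for m
    unfolding box by (rule finite_functions_default[OF fin]) auto
  have cardbox: "card (height_box E m) = m ^ card E" for m
    unfolding box by (subst card_functions_default[OF fin]) auto
  have finZ: "finite ?Z" using finite_Fp_vectors[OF fin] by simp
  have fibre: "{w\<in>S \<inter> height_box E m. ?res w = z} =
      {w. (\<forall>e\<in>E. w e \<in> {k\<in>{1..m}. k mod p = nat (z e)}) \<and> (\<forall>e. e \<notin> E \<longrightarrow> w e = 0)}" (is "?L = ?R")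
    if z: "z \<in> ?Z" for m z
  proof (intro Set.set_eqI iffI)
    fix w assume "w \<in> ?L"
    then show "w \<in> ?R" by (auto simp: height_box_def simp flip: of_nat_mod)
  next
    fix w assume w: "w \<in> ?R"
    have "?res w e = z e" for e
    proof (cases "e \<in> E")
      case True
      then have "w e mod p = nat (z e)" "0 \<le> z e" using w z by (auto simp: Fp_vectors_def)
      then show ?thesis by (simp flip: of_nat_mod)
    next
      case False
      then show ?thesis using w z by (simp add: Fp_vectors_def)
    qed
    then have "?res w = z" by blast
    moreover have "w \<in> height_box E m" using w by (auto simp: height_box_def)
    moreover have "w \<in> S \<longleftrightarrow> P (?res w)" using w by (intro S) auto
    ultimately show "w \<in> ?L" using z by auto
  qed
  have count: "card (S \<inter> height_box E m) = (\<Sum>z\<in>?Z. \<Prod>e\<in>E. ?c m (z e))" for m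
  proof -
    have "?res ` (S \<inter> height_box E m) \<subseteq> ?Z"
    proof safe
      fix w assume w: "w \<in> S" "w \<in> height_box E m"
      show "?res w \<in> Fp_vectors p E" using w p by (auto simp: height_box_def Fp_vectors_def)
      show "P (?res w)" using S[of w] w by (auto simp: height_box_def)
    qed
    then have "(\<Sum>z\<in>?Z. \<Sum>w\<in>{w\<in>S \<inter> height_box E m. ?res w = z}. 1::nat) = (\<Sum>w\<in>S \<inter> height_box E m. 1)"
      using finbox finZ by (intro sum.group) auto
    then have "card (S \<inter> height_box E m) = (\<Sum>z\<in>?Z. card {w\<in>S \<inter> height_box E m. ?res w = z})"
      by simp
    also have "\<dots> = (\<Sum>z\<in>?Z. \<Prod>e\<in>E. ?c m (z e))"
      by (rule sum.cong[OF refl], subst fibre, assumption, rule card_functions_default[OF fin])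
    finally show ?thesis .
  qed
  have ratio: "density_ratio E S m = (\<Sum>z\<in>?Z. \<Prod>e\<in>E. real (?c m (z e)) / real m)" for m
    by (simp add: density_ratio_def count cardbox sum_divide_distrib prod_dividef)
  have "(\<lambda>m. \<Sum>z\<in>?Z. \<Prod>e\<in>E. real (?c m (z e)) / real m) \<longlonglongrightarrow> (\<Sum>z\<in>?Z. \<Prod>e\<in>E. 1 / real p)"
    by (intro tendsto_sum tendsto_prod residue_class_density p) (auto simp: Fp_vectors_def)
  moreover have "(\<Sum>z\<in>?Z. \<Prod>e\<in>E. 1 / real p) = real (card ?Z) / real (p ^ card E)"
    by (simp add: power_one_over)
  ultimately show ?thesis unfolding ratio by simp
qed

section \<open>Projective points as scaling classes of nonzero vectors\<close>

lemma equiv_proj_rel: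
  assumes p: "prime p"
  shows "equiv (Fp_vectors p E - {\<lambda>_. 0}) (proj_rel p E)"
proof (rule equivI)
  have p1: "1 < int p" using prime_gt_1_nat[OF p] by simp
  have vmod: "x e mod int p = x e" if "x \<in> Fp_vectors p E" for x e
    using that by (cases "e \<in> E") (auto simp: Fp_vectors_def)
  show "proj_rel p E \<subseteq> (Fp_vectors p E - {\<lambda>_. 0}) \<times> (Fp_vectors p E - {\<lambda>_. 0})"
    by (auto simp: proj_rel_def)
  show "refl_on (Fp_vectors p E - {\<lambda>_. 0}) (proj_rel p E)"
  proof (rule refl_onI)
    fix x assume x: "x \<in> Fp_vectors p E - {\<lambda>_. 0}"
    then have x1: "x = (\<lambda>e. (1 * x e) mod int p)" using vmod[of x] by auto
    have "\<exists>a>0. a < int p \<and> x = (\<lambda>e. (a * x e) mod int p)"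
      by (intro exI[of _ 1] conjI x1) (use p1 in simp_all)
    then show "(x, x) \<in> proj_rel p E" using x unfolding proj_rel_def by blast
  qed
  show "sym (proj_rel p E)"
  proof (rule symI)
    fix x y assume xy: "(x, y) \<in> proj_rel p E"
    then obtain a where a: "0 < a" "a < int p" "y = (\<lambda>e. (a * x e) mod int p)"
      and V: "x \<in> Fp_vectors p E - {\<lambda>_. 0}" "y \<in> Fp_vectors p E - {\<lambda>_. 0}" by (auto simp: proj_rel_def)
    have "coprime a (int p)"
      using a p by (metis coprime_commute prime_imp_coprime prime_nat_int_transfer zdvd_not_zless)
    \<comment> \<open>Bezout supplies the inverse scalar; it is reduced modulo \<open>p\<close>
      afterwards because \<open>proj_rel\<close> admits only scalars strictly between 0 and
      \<open>p\<close>.\<close>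
    then obtain b v where "b * a + v * int p = 1" using bezout_int[of a "int p"] by (auto simp: coprime_iff_gcd_eq_1)
    then have b: "a * b = 1 - v * int p" by (simp add: algebra_simps)
    define b' where "b' = b mod int p"
    have "(a * b') mod int p = (1 - v * int p) mod int p" by (simp add: b'_def mod_mult_right_eq b)
    also have "\<dots> = 1" using p1 by (simp add: mod_diff_right_eq[symmetric])
    finally have ab: "(a * b') mod int p = 1" .
    then have "b' \<noteq> 0" using p1 by auto
    then have b': "0 < b'" "b' < int p"
      using p1 pos_mod_bound[of "int p" b] pos_mod_sign[of "int p" b] unfolding b'_def by linarith+
    have "(b' * y e) mod int p = x e" for e
    proof -
      have "(b' * y e) mod int p = ((a * b') mod int p * x e) mod int p"
        unfolding a(3) by (simp add: mod_mult_left_eq mod_mult_right_eq mult_ac)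
      then show ?thesis using ab vmod V by simp
    qed
    then have "x = (\<lambda>e. (b' * y e) mod int p)" by auto
    then show "(y, x) \<in> proj_rel p E" using V b' unfolding proj_rel_def by blast
  qed
  show "trans (proj_rel p E)"
  proof (rule transI)
    fix x y z assume xy: "(x, y) \<in> proj_rel p E" and yz: "(y, z) \<in> proj_rel p E"
    obtain a where a: "0 < a" "a < int p" "y = (\<lambda>e. (a * x e) mod int p)" using xy by (auto simp: proj_rel_def)
    obtain b where b: "0 < b" "b < int p" "z = (\<lambda>e. (b * y e) mod int p)" using yz by (auto simp: proj_rel_def)
    define c where "c = (b * a) mod int p"
    have "z = (\<lambda>e. (c * x e) mod int p)"
      unfolding b(3) a(3) c_def by (simp add: mod_mult_left_eq mod_mult_right_eq mult_ac)
    moreover have "\<not> int p dvd b * a"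
      using a b p by (metis prime_dvd_mult_iff prime_nat_int_transfer zdvd_not_zless)
    then have "c \<noteq> 0" by (auto simp: c_def)
    then have "0 < c" "c < int p"
      using p1 pos_mod_bound[of "int p" "b * a"] pos_mod_sign[of "int p" "b * a"] unfolding c_def by linarith+
    ultimately have "\<exists>a>0. a < int p \<and> z = (\<lambda>e. (a * x e) mod int p)" by blast
    moreover have "x \<in> Fp_vectors p E - {\<lambda>_. 0}" "z \<in> Fp_vectors p E - {\<lambda>_. 0}"
      using xy yz by (auto simp: proj_rel_def)
    ultimately show "(x, z) \<in> proj_rel p E" unfolding proj_rel_def by blast
  qed
qed

text \<open>A nonzero coordinate of \<open>x\<close> is invertible modulo \<open>p\<close>, so
  distinct scalars give distinct multiples.\<close>

lemma card_proj_class: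
  assumes p: "prime p" and x: "x \<in> Fp_vectors p E - {\<lambda>_. 0}"
  shows "card (proj_rel p E `` {x}) = p - 1"
proof -
  let ?f = "\<lambda>a e. (a * x e) mod int p"
  have p1: "1 < int p" using prime_gt_1_nat[OF p] by simp
  obtain e0 where e0: "x e0 \<noteq> 0" using x by auto
  have "e0 \<in> E" "0 \<le> x e0" "x e0 < int p" using x e0 p1 unfolding Fp_vectors_def by force+
  then have "0 < x e0" "x e0 < int p" using e0 by auto
  then have nd: "\<not> int p dvd x e0" by (simp add: zdvd_not_zless)
  have "proj_rel p E `` {x} = ?f ` {0<..<int p}"
  proof safe
    fix y assume "(x, y) \<in> proj_rel p E"
    then show "y \<in> ?f ` {0<..<int p}" by (auto simp: proj_rel_def)
  next
    fix a assume a: "a \<in> {0<..<int p}"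
    then have "\<not> int p dvd a" by (simp add: zdvd_not_zless)
    then have "\<not> int p dvd a * x e0" using nd p by (metis prime_dvd_mult_iff prime_nat_int_transfer)
    then have "?f a e0 \<noteq> 0" by auto
    then have "?f a \<noteq> (\<lambda>_. 0)" by metis
    moreover have "?f a \<in> Fp_vectors p E" using x p1 by (auto simp: Fp_vectors_def)
    ultimately show "(x, ?f a) \<in> proj_rel p E" using x a unfolding proj_rel_def by auto
  qed
  moreover have "inj_on ?f {0<..<int p}"
  proof (rule inj_onI)
    fix a b assume ab: "a \<in> {0<..<int p}" "b \<in> {0<..<int p}" and "?f a = ?f b"
    then have "(a * x e0) mod int p = (b * x e0) mod int p" by meson
    then have "int p dvd (a - b) * x e0" by (simp add: mod_eq_dvd_iff left_diff_distrib)
    then have "int p dvd a - b" using nd p by (metis prime_dvd_mult_iff prime_nat_int_transfer)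
    then have "a mod int p = b mod int p" by (simp add: mod_eq_dvd_iff)
    then show "a = b" using ab by simp
  qed
  ultimately have "card (proj_rel p E `` {x}) = card {0<..<int p}" by (simp add: card_image)
  then show ?thesis using p1 by simp
qed

text \<open>For a scaling-invariant \<open>P\<close>, the classes inside \<open>P\<close> partition
  the nonzero vectors satisfying it. Vanishing of the configuration polynomial gives the numerator
  of the density, the property that always holds gives the denominator.\<close>

lemma card_proj_points_invariant:
  assumes p: "prime p" and fin: "finite E"
    and inv: "\<And>x y. (x, y) \<in> proj_rel p E \<Longrightarrow> P x \<longleftrightarrow> P y"
  shows "(p - 1) * card {c\<in>proj_points p E. \<forall>x\<in>c. P x} = card {x\<in>Fp_vectors p E - {\<lambda>_. 0}. P x}"
proof -
  let ?V = "Fp_vectors p E - {\<lambda>_. 0}"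
  let ?C = "{c\<in>proj_points p E. \<forall>x\<in>c. P x}"
  note eq = equiv_proj_rel[OF p, of E]
  have U: "\<Union>?C = {x\<in>?V. P x}"
  proof (intro Set.set_eqI iffI)
    fix x assume "x \<in> \<Union>?C"
    then obtain c where "c \<in> proj_points p E" "\<forall>x\<in>c. P x" "x \<in> c" by blast
    then show "x \<in> {x\<in>?V. P x}" using Union_quotient[OF eq] unfolding proj_points_def by blast
  next
    fix x assume x: "x \<in> {x\<in>?V. P x}"
    have "proj_rel p E `` {x} \<in> proj_points p E" unfolding proj_points_def using x by (intro quotientI) blast
    moreover have "\<forall>y\<in>proj_rel p E `` {x}. P y" using inv x by blast
    moreover have "x \<in> proj_rel p E `` {x}" using equiv_class_self[OF eq] x by blast
    ultimately show "x \<in> \<Union>?C" by blast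
  qed
  have finV: "finite ?V" using finite_Fp_vectors[OF fin] by simp
  have "(p - 1) * card ?C = card (\<Union>?C)"
  proof (rule card_partition)
    have "proj_rel p E \<subseteq> ?V \<times> ?V" by (auto simp: proj_rel_def)
    then have "finite (?V // proj_rel p E)" using finV finite_quotient by blast
    then show "finite ?C" by (simp add: proj_points_def)
    show "finite (\<Union>?C)" unfolding U using finV by simp
    show "card c = p - 1" if "c \<in> ?C" for c
      using that card_proj_class[OF p] unfolding proj_points_def by (auto elim!: quotientE)
    show "c1 \<inter> c2 = {}" if "c1 \<in> ?C" "c2 \<in> ?C" "c1 \<noteq> c2" for c1 c2
      using quotient_disj[OF eq] that unfolding proj_points_def by blast
  qed
  then show ?thesis unfolding U .
qed

section \<open>The order of the Jacobian as a value of the configuration polynomial, and the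
  density\<close>

lemma jac_card_metric:
  assumes fin: "finite E" and reg: "regular_matroid E \<B>" and w: "\<forall>e\<in>E. 1 \<le> w e"
  shows "int (jac_card (metric_ground E w) (metric_bases E \<B> w)) = mpoly_eval (config_poly E \<B>) (\<lambda>e. int (w e))"
proof -
  obtain r A where rep: "tu_rep E \<B> r A" using reg by (auto simp: regular_matroid_def)
  have ne: "\<B> \<noteq> {}" and sub: "\<forall>B\<in>\<B>. B \<subseteq> E" using reg by (auto simp: regular_matroid_def matroid_bases_def)
  obtain r' A' where rep': "tu_rep (metric_ground E w) (metric_bases E \<B> w) r' A'"
    using tu_rep_metric[OF fin ne w rep] by blast
  have fin': "finite (metric_ground E w)" by (rule finite_metric_ground[OF fin])
  obtain B where "B \<in> \<B>" using ne by blast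
  \<comment> \<open>Removing \<open>(e, 0)\<close> from each fibre over \<open>E - B\<close> is
    always admissible, since every \<open>w e\<close> is at least 1.\<close>
  then have "metric_ground E w - {(e, (\<lambda>_. 0) e) | e. e \<in> E - B} \<in> metric_bases E \<B> w"
    unfolding metric_bases_def
    by (intro CollectI exI[of _ B] exI[of _ "\<lambda>_. 0"]) (use w in \<open>auto simp: Suc_le_eq\<close>)
  then have "metric_bases E \<B> w \<noteq> {}" by blast
  then have "jac_card (metric_ground E w) (metric_bases E \<B> w) = card (metric_bases E \<B> w)"
    using jac_card_eq_card_bases[OF fin' _ rep'] by blast
  also have "\<dots> = (\<Sum>B\<in>\<B>. \<Prod>e\<in>E - B. w e)" by (rule card_metric_bases[OF fin sub])
  finally show ?thesis by (simp add: mpoly_eval_config_poly[OF fin sub])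
qed

text \<open>All bases have \<open>r\<close> elements, so every monomial has degree
  \<open>card E - r\<close>. Degree 0 would leave \<open>E\<close> as the only basis and make the
  polynomial 1.\<close>

lemma config_poly_homogeneous:
  assumes fin: "finite E" and reg: "regular_matroid E \<B>" and ne1: "config_poly E \<B> \<noteq> 1"
  obtains d where "0 < d" "\<And>B. B \<in> \<B> \<Longrightarrow> card (E - B) = d"
proof -
  obtain r A where rep: "tu_rep E \<B> r A" using reg by (auto simp: regular_matroid_def)
  have ne: "\<B> \<noteq> {}" using reg by (auto simp: regular_matroid_def matroid_bases_def)
  have B: "B \<subseteq> E \<and> card B = r" if "B \<in> \<B>" for B using that rep by (auto simp: tu_rep_def col_basis_def)
  have d: "card (E - B) = card E - r" if "B \<in> \<B>" for B
    using B[OF that] fin by (metis card_Diff_subset finite_subset)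
  moreover have "card E - r \<noteq> 0"
  proof
    assume "card E - r = 0"
    then have "B = E" if "B \<in> \<B>" for B
      using d[OF that] B[OF that] fin by (simp add: subset_antisym)
    then have "\<B> = {E}" using ne by blast
    then show False using ne1 by (simp add: config_poly_def)
  qed
  ultimately show thesis using that by blast
qed

theorem theorem6p4:
  fixes p :: nat and E :: "'a set" and \<B> :: "'a set set"
  assumes "prime p"
    and "finite E"
    and "regular_matroid E \<B>"
    and "config_poly E \<B> \<noteq> 1"
  shows "density_ratio E (Jp_set p E \<B>) \<longlonglongrightarrow>
    (real (p - 1) * real (card (config_points p E \<B>)) + 1) /
    (real (p - 1) * real (card (proj_points p E)) + 1)"
proof -
  let ?V = "Fp_vectors p E"
  define \<Psi> where "\<Psi> x = mpoly_eval (config_poly E \<B>) x" for x :: "'a \<Rightarrow> int"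
  have p0: "0 < p" using prime_gt_0_nat[OF assms(1)] .
  have sub: "\<forall>B\<in>\<B>. B \<subseteq> E" using assms(3) by (auto simp: regular_matroid_def matroid_bases_def)
  have \<Psi>: "\<Psi> x = (\<Sum>B\<in>\<B>. \<Prod>e\<in>E - B. x e)" for x
    unfolding \<Psi>_def by (rule mpoly_eval_config_poly[OF assms(2) sub])
  obtain d where d: "0 < d" "\<And>B. B \<in> \<B> \<Longrightarrow> card (E - B) = d"
    using config_poly_homogeneous[OF assms(2-4)] by blast
  have hom: "\<Psi> (\<lambda>e. a * x e) = a ^ d * \<Psi> x" for a x
    by (simp add: \<Psi> prod.distrib d(2) sum_distrib_left)
  \<comment> \<open>Integer coefficients make divisibility depend on residues alone. This serves
    both the periodicity in the density argument and the reduction built into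
    \<open>proj_rel\<close>.\<close>
  have mod: "int p dvd \<Psi> (\<lambda>e. x e mod int p) \<longleftrightarrow> int p dvd \<Psi> x" for x
  proof -
    have "\<Psi> (\<lambda>e. x e mod int p) mod int p = \<Psi> x mod int p"
      unfolding \<Psi> by (subst (1 2) mod_sum_eq[symmetric]) (simp add: mod_prod_eq)
    then show ?thesis by (simp add: dvd_eq_mod_eq_0)
  qed
  have "density_ratio E (Jp_set p E \<B>) \<longlonglongrightarrow> real (card {z\<in>?V. int p dvd \<Psi> z}) / real (p ^ card E)"
  proof (rule density_ratio_periodic[OF p0 assms(2)])
    fix w :: "'a \<Rightarrow> nat" assume w: "\<forall>e\<in>E. 1 \<le> w e" "\<forall>e. e \<notin> E \<longrightarrow> w e = 0"
    have "w \<in> Jp_set p E \<B> \<longleftrightarrow> int p dvd int (jac_card (metric_ground E w) (metric_bases E \<B> w))"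
      using w by (simp add: Jp_set_def)
    also have "\<dots> \<longleftrightarrow> int p dvd \<Psi> (\<lambda>e. int (w e))"
      unfolding jac_card_metric[OF assms(2,3) w(1)] \<Psi>_def ..
    finally show "w \<in> Jp_set p E \<B> \<longleftrightarrow> int p dvd \<Psi> (\<lambda>e. int (w e) mod int p)"
      by (simp add: mod)
  qed
  moreover have "card {z\<in>?V. int p dvd \<Psi> z} = (p - 1) * card (config_points p E \<B>) + 1"
  proof -
    have inv: "int p dvd \<Psi> x \<longleftrightarrow> int p dvd \<Psi> y" if xy: "(x, y) \<in> proj_rel p E" for x y
    proof -
      obtain a where a: "0 < a" "a < int p" "y = (\<lambda>e. (a * x e) mod int p)"
        using xy by (auto simp: proj_rel_def)
      have "int p dvd \<Psi> y \<longleftrightarrow> int p dvd a ^ d * \<Psi> x" unfolding a(3) mod hom ..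
      moreover have "\<not> int p dvd a ^ d"
        using a(1,2) assms(1) by (metis prime_dvd_power prime_nat_int_transfer zdvd_not_zless)
      ultimately show ?thesis
        using assms(1) by (simp add: prime_dvd_mult_iff)
    qed
    \<comment> \<open>Positive degree puts the origin among the zeros; it accounts for the summand 1
      in the numerator.\<close>
    have "\<Psi> (\<lambda>_. 0) = 0" using hom[of 0 "\<lambda>_. 0"] d(1) by (simp add: power_0_left)
    then have "{z\<in>?V. int p dvd \<Psi> z} = insert (\<lambda>_. 0) {x\<in>?V - {\<lambda>_. 0}. int p dvd \<Psi> x}"
      using zero_in_Fp_vectors[OF p0, of E] by auto
    then have "card {z\<in>?V. int p dvd \<Psi> z} = Suc (card {x\<in>?V - {\<lambda>_. 0}. int p dvd \<Psi> x})"
      using finite_Fp_vectors[OF assms(2), of p] by simp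
    also have "card {x\<in>?V - {\<lambda>_. 0}. int p dvd \<Psi> x} = (p - 1) * card (config_points p E \<B>)"
      unfolding config_points_def
      using card_proj_points_invariant[OF assms(1,2), of "\<lambda>x. int p dvd \<Psi> x"] inv by (simp add: \<Psi>_def)
    finally show ?thesis by simp
  qed
  moreover have "p ^ card E = (p - 1) * card (proj_points p E) + 1"
  proof -
    have "card ?V = Suc (card (?V - {\<lambda>_. 0}))"
      using card_Suc_Diff1[OF finite_Fp_vectors[OF assms(2)] zero_in_Fp_vectors[OF p0]] by simp
    also have "card (?V - {\<lambda>_. 0}) = (p - 1) * card (proj_points p E)"
    proof -
      have "{x\<in>?V - {\<lambda>_. 0}. True} = ?V - {\<lambda>_. 0}" by blast
      moreover have "{c\<in>proj_points p E. \<forall>x\<in>c. True} = proj_points p E" by blast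
      ultimately show ?thesis using card_proj_points_invariant[OF assms(1,2), of "\<lambda>_. True"] by metis
    qed
    finally show ?thesis using card_Fp_vectors[OF assms(2)] by simp
  qed
  ultimately show ?thesis by (simp add: add.commute)
qed

end
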